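(* Let $n\ge 2$. For each $j=1,\ldots,n$ let $\phi_{k_j}:(\mathbb{C},0)\to(\mathbb{C}^{k_j},0)$ be a primitive parameterized curve of the form $$\phi_{k_j}(y_j)=\Big(y_j^{m_j},\ y_j^{m_{j2}}+\sum_{i>m_{j2}}a^{(j)}_{i2}y_j^i,\ \ldots,\ y_j^{m_{jk_j}}+\sum_{i>m_{jk_j}}a^{(j)}_{ik_j}y_j^i\Big)$$ with $1<m_j\le m_{j2}\le\cdots\le m_{jk_j}$. Write $\underline{y}=(y_1,\ldots,y_n)$, and for each $j$ let $H_j:(\mathbb{C}^n,0)\to(\mathbb{C}^{n-1},0)$ be $$H_j(\underline{y})=(y_j^{\mu_{j1}}y_1,\ldots,y_j^{\mu_{j(j-1)}}y_{j-1},\,y_j^{\mu_{j(j+1)}}y_{j+1},\ldots,y_j^{\mu_{jn}}y_n),$$ where $\mu_{js}\ge 1$ are integers for all $s\ne j$. Let $H=(H_1,\ldots,H_n):(\mathbb{C}^n,0)\to(\mathbb{C}^{n(n-1)},0)$ and $p=\sum_{j=1}^n k_j+n(n-1)$ (so $p\ge 2n$). Then the map-germ $(\phi_{k_1}*\cdots*\phi_{k_n})_H:(\mathbb{C}^n,0)\to(\mathbb{C}^p,0)$, $$(\phi_{k_1}*\cdots*\phi_{k_n})_H(\underline{y})=(\phi_{k_1}(y_1),\ldots,\phi_{k_n}(y_n),H(\underline{y})),$$ is $\mathcal{A}$-finite and has corank $n$.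
   Context: All germs are holomorphic. Two germs $f,g:(\mathbb{C}^n,0)\to(\mathbb{C}^p,0)$ are $\mathcal{A}$-equivalent if $g=\psi\circ f\circ\rho^{-1}$ for germs of biholomorphisms $\rho$ of $(\mathbb{C}^n,0)$ and $\psi$ of $(\mathbb{C}^p,0)$. A germ $f$ is $\mathcal{A}$-finite (finitely determined) if there is $r<\infty$ such that every germ $g:(\mathbb{C}^n,0)\to(\mathbb{C}^p,0)$ with the same $r$-jet at $0$ as $f$ is $\mathcal{A}$-equivalent to $f$. The corank of $f:(\mathbb{C}^n,0)\to(\mathbb{C}^p,0)$, $p\ge n$, is $n-\operatorname{rank} df_0$. A parameterized curve of the displayed form is primitive if the greatest common divisor of all exponents occurring with nonzero coefficient in its components equals $1$, equivalently it is not a germ in a power $y^d$ with $d\ge 2$. *)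

theory Defs
  imports "HOL-Analysis.Analysis"
begin

section \<open>Holomorphic map-germs\<close>

text \<open>
  A germ \<open>(\<complex>\<^sup>n,0) \<rightarrow> (\<complex>\<^sup>p,0)\<close> is represented by a total function that is holomorphic
  on a neighbourhood of \<open>0\<close>; two functions represent the same germ iff they are equal eventually
  in \<open>nhds 0\<close>. Complex differentiability means that the Frechet derivative, which in the library is
  real linear, is given by a complex matrix.
\<close>

definition holomorphic_map_on :: "(complex^'n \<Rightarrow> complex^'p) \<Rightarrow> (complex^'n) set \<Rightarrow> bool" where
  "holomorphic_map_on f U \<longleftrightarrow>
     (\<forall>x\<in>U. \<exists>A :: complex^'n^'p. (f has_derivative (\<lambda>h. A *v h)) (at x within U))"

definition map_germ :: "(complex^'n \<Rightarrow> complex^'p) \<Rightarrow> bool" where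
  "map_germ f \<longleftrightarrow> f 0 = 0 \<and> (\<exists>U. open U \<and> 0 \<in> U \<and> holomorphic_map_on f U)"

definition inverse_germs :: "(complex^'n \<Rightarrow> complex^'n) \<Rightarrow> (complex^'n \<Rightarrow> complex^'n) \<Rightarrow> bool" where
  "inverse_germs \<rho> \<sigma> \<longleftrightarrow> map_germ \<rho> \<and> map_germ \<sigma> \<and>
     (\<forall>\<^sub>F x in nhds 0. \<sigma> (\<rho> x) = x) \<and> (\<forall>\<^sub>F x in nhds 0. \<rho> (\<sigma> x) = x)"

definition biholomorphic_germ :: "(complex^'n \<Rightarrow> complex^'n) \<Rightarrow> bool" where
  "biholomorphic_germ \<rho> \<longleftrightarrow> (\<exists>\<sigma>. inverse_germs \<rho> \<sigma>)"

text \<open>In the following definition \<open>\<sigma>\<close> is the inverse germ of \<open>\<rho>\<close>.\<close>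

definition A_equivalent :: "(complex^'n \<Rightarrow> complex^'p) \<Rightarrow> (complex^'n \<Rightarrow> complex^'p) \<Rightarrow> bool" where
  "A_equivalent f g \<longleftrightarrow>
     (\<exists>\<rho> \<sigma> \<psi>. inverse_germs \<rho> \<sigma> \<and> biholomorphic_germ \<psi> \<and>
        (\<forall>\<^sub>F x in nhds 0. g x = \<psi> (f (\<sigma> x))))"

definition partial_deriv :: "'n \<Rightarrow> (complex^'n \<Rightarrow> complex) \<Rightarrow> complex^'n \<Rightarrow> complex" where
  "partial_deriv s u = (\<lambda>x. deriv (\<lambda>t. u (x + axis s t)) 0)"

text \<open>
  The list \<open>[s\<^sub>1, \<dots>, s\<^sub>d]\<close> of variables encodes the operator
  \<open>\<partial>\<^sup>d / \<partial>s\<^sub>1 \<dots> \<partial>s\<^sub>d\<close>.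
  Having the same \<open>r\<close>-jet at \<open>0\<close> means that all partial derivatives of order at most \<open>r\<close>
  of all components agree at \<open>0\<close>.
\<close>

definition iterated_partial_deriv :: "'n list \<Rightarrow> (complex^'n \<Rightarrow> complex) \<Rightarrow> complex^'n \<Rightarrow> complex" where
  "iterated_partial_deriv ss u = foldr partial_deriv ss u"

definition same_jet :: "nat \<Rightarrow> (complex^'n \<Rightarrow> complex^'p) \<Rightarrow> (complex^'n \<Rightarrow> complex^'p) \<Rightarrow> bool" where
  "same_jet r f g \<longleftrightarrow>
     (\<forall>ss q. length ss \<le> r \<longrightarrow>
        iterated_partial_deriv ss (\<lambda>x. f x $ q) 0 = iterated_partial_deriv ss (\<lambda>x. g x $ q) 0)"

definition A_finite :: "(complex^'n \<Rightarrow> complex^'p) \<Rightarrow> bool" where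
  "A_finite f \<longleftrightarrow> map_germ f \<and>
     (\<exists>r. \<forall>g. map_germ g \<and> same_jet r f g \<longrightarrow> A_equivalent f g)"

text \<open>
  The Jacobian of a holomorphic map is a complex matrix, so \<open>rank\<close> is the complex rank.
  The truncated subtraction is harmless because the rank is at most \<open>n\<close>.
\<close>

definition corank :: "(complex^'n \<Rightarrow> complex^'p) \<Rightarrow> nat" where
  "corank f = CARD('n) - rank (jacobian f (at 0) :: complex^'n^'p)"


section \<open>Joins of parameterized curves\<close>

text \<open>
  The components of the curve are numbered from \<open>1\<close>. Component \<open>1\<close> is the pure power
  \<open>y\<^bsup>m 1\<^esup>\<close>; component \<open>l \<ge> 2\<close> is \<open>y\<^bsup>m l\<^esup> + (\<Sum>i>m l. a l i * y\<^sup>i)\<close>.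
\<close>

definition curve_component :: "(nat \<Rightarrow> nat) \<Rightarrow> (nat \<Rightarrow> nat \<Rightarrow> complex) \<Rightarrow> nat \<Rightarrow> complex fps" where
  "curve_component m a l =
     fps_X ^ m l + (if l = 1 then 0 else Abs_fps (\<lambda>i. if m l < i then a l i else 0))"

definition primitive_curve :: "nat \<Rightarrow> (nat \<Rightarrow> complex fps) \<Rightarrow> bool" where
  "primitive_curve k \<phi> \<longleftrightarrow> Gcd {i. \<exists>l\<in>{1..k}. fps_nth (\<phi> l) i \<noteq> 0} = 1"

text \<open>
  The coordinates of the target are the pairs \<open>(j, l)\<close> with \<open>1 \<le> l \<le> k j\<close>, for the components
  of the curves, and the pairs \<open>(j, s)\<close> with \<open>s \<noteq> j\<close>, for the components of the maps \<open>H\<^sub>j\<close>.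
  A map \<open>e\<close> that is a bijection from the index type \<open>'p\<close> onto this set says which coordinate
  of \<open>\<complex>\<^sup>p\<close> is which; in particular it fixes the value of \<open>p\<close>.
\<close>

definition join_index :: "('n \<Rightarrow> nat) \<Rightarrow> (('n \<times> nat) + ('n \<times> 'n)) set" where
  "join_index k = (SIGMA j:UNIV. {1..k j}) <+> {(j, s). s \<noteq> j}"

lemma card_join_index:
  fixes k :: "'n::finite \<Rightarrow> nat"
  shows "card (join_index k) = (\<Sum>j\<in>UNIV. k j) + CARD('n) * (CARD('n) - 1)"
proof -
  have eq: "{(j, s). s \<noteq> j} = (SIGMA j:(UNIV::'n set). UNIV - {j})"
    by auto
  have "card {(j::'n, s). s \<noteq> j} = CARD('n) * (CARD('n) - 1)"
    unfolding eq by (subst card_SigmaI) (auto simp: card_Diff_singleton)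
  moreover have "card (SIGMA j:(UNIV::'n set). {1..k j}) = (\<Sum>j\<in>UNIV. k j)"
    by (subst card_SigmaI) auto
  ultimately show ?thesis
    unfolding join_index_def by (subst card_Plus) auto
qed

definition curve_join ::
    "('n \<Rightarrow> nat \<Rightarrow> complex fps) \<Rightarrow> ('n \<Rightarrow> 'n \<Rightarrow> nat) \<Rightarrow>
     ('p \<Rightarrow> ('n \<times> nat) + ('n \<times> 'n)) \<Rightarrow> complex^'n \<Rightarrow> complex^'p" where
  "curve_join \<phi> \<mu> e y = (\<chi> q. case e q of
       Inl (j, l) \<Rightarrow> eval_fps (\<phi> j l) (y $ j)
     | Inr (j, s) \<Rightarrow> (y $ j) ^ \<mu> j s * y $ s)"

end

theory Submission
  imports Defs "HOL-Complex_Analysis.Complex_Analysis"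
begin

text \<open>
  The germ \<open>F\<close> is even finitely determined under changes of coordinates in the target only.
  Let \<open>R\<close> be the ring of all germs \<open>h \<circ> F\<close> with \<open>h\<close> holomorphic. If every germ \<open>u\<close> with a zero jet of
  sufficiently high order is \<open>h \<circ> F\<close> with \<open>h\<close> vanishing to second order, then a germ \<open>g\<close> with the
  same jet as \<open>F\<close> is \<open>(id + h) \<circ> F\<close>, and \<open>id + h\<close> is a biholomorphic germ. Such a \<open>u\<close> is a sum of terms
  \<open>y\<^sub>j\<^sup>K v(y)\<close>, and \<open>v\<close> is a sum of terms \<open>y\<^sup>\<beta> V(y\<^sub>1\<^bsup>m1\<^esup>, \<dots>, y\<^sub>n\<^bsup>mn\<^esup>)\<close> with \<open>\<beta>\<^sub>s < m\<^sub>s\<close> by Weierstrass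
  division. The factor \<open>V\<close> lies in \<open>R\<close> because the pure powers are coordinates of \<open>F\<close>, and
  \<open>y\<^sub>j\<^sup>K y\<^sup>\<beta>\<close> is a product of the coordinates \<open>y\<^sub>j\<^bsup>\<mu>js\<^esup> y\<^sub>s\<close> and a high power of \<open>y\<^sub>j\<close>. Finally all
  high powers of \<open>y\<^sub>j\<close> lie in \<open>R\<close> because the curve \<open>\<phi>\<^sub>j\<close> is primitive, hence separates
  \<open>y\<close> from \<open>\<zeta>\<^sup>s y\<close> for the nontrivial \<open>m\<^sub>j\<close>-th roots of unity \<open>\<zeta>\<^sup>s\<close>.
\<close>

no_notation fps_nth (infixl "$" 75)

section \<open>Holomorphic functions of several variables\<close>

text \<open>The library derivative is real linear, so homogeneity over the complex numbers is all
  that is missing for complex linearity. The filter \<open>at x\<close> makes this a statement about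
  full neighbourhoods of the points of \<open>U\<close>.\<close>

definition hol_on :: "(complex^'n \<Rightarrow> complex) \<Rightarrow> (complex^'n) set \<Rightarrow> bool" where
  "hol_on u U \<longleftrightarrow>
     (\<forall>x\<in>U. \<exists>D. (u has_derivative D) (at x) \<and> (\<forall>c h. D (c *s h) = c * D h))"

text \<open>Polydiscs rather than balls: one coordinate may be replaced by any number of modulus
  below \<open>r\<close> without leaving the set, which is what slicing and Cauchy integrals in one
  variable require.\<close>

definition polydisc :: "real \<Rightarrow> (complex^'n) set" where
  "polydisc r = {x. \<forall>i. norm (x $ i) < r}"

definition vupd :: "complex^'n \<Rightarrow> 'n \<Rightarrow> complex \<Rightarrow> complex^'n" where
  "vupd x s z = (\<chi> i. if i = s then z else x $ i)"

lemma vupd_nth [simp]: "vupd x s z $ i = (if i = s then z else x $ i)"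
  by (simp add: vupd_def)

lemma vupd_triv [simp]: "vupd x s (x $ s) = x"
  by (simp add: vec_eq_iff)

lemma open_polydisc [simp, intro]: "open (polydisc r :: (complex^'n::finite) set)"
proof -
  have "polydisc r = (\<Inter>i. {x :: complex^'n. norm (x $ i) < r})"
    by (auto simp: polydisc_def)
  moreover have "open {x :: complex^'n. norm (x $ i) < r}" for i
    by (intro open_Collect_less continuous_intros)
  ultimately show ?thesis
    by (auto intro: open_INT)
qed

lemma convex_polydisc [simp, intro]: "convex (polydisc r :: (complex^'n::finite) set)"
proof (rule convexI)
  fix x y :: "complex^'n" and u v :: real
  assume xy: "x \<in> polydisc r" "y \<in> polydisc r" and uv: "0 \<le> u" "0 \<le> v" "u + v = 1"
  have "norm ((u *\<^sub>R x + v *\<^sub>R y) $ i) < r" for i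
  proof -
    have "x $ i \<in> ball 0 r" "y $ i \<in> ball 0 r"
      using xy by (auto simp: polydisc_def)
    then have "u *\<^sub>R (x $ i) + v *\<^sub>R (y $ i) \<in> ball 0 r"
      using convexD[OF convex_ball] uv by blast
    then show ?thesis by simp
  qed
  then show "u *\<^sub>R x + v *\<^sub>R y \<in> polydisc r"
    by (simp add: polydisc_def)
qed

lemma zero_in_polydisc [simp]: "0 \<in> polydisc r \<longleftrightarrow> 0 < r"
  by (simp add: polydisc_def)

lemma polydisc_mono: "r \<le> s \<Longrightarrow> polydisc r \<subseteq> polydisc s"
  by (auto simp: polydisc_def intro: less_le_trans)

lemma eventually_polydisc: "0 < r \<Longrightarrow> \<forall>\<^sub>F x in nhds 0. x \<in> (polydisc r :: (complex^'n::finite) set)"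
  by (rule eventually_nhds_in_open) auto

lemma open_contains_polydisc:
  fixes U :: "(complex^'n::finite) set"
  assumes "open U" "0 \<in> U"
  obtains r where "0 < r" "polydisc r \<subseteq> U"
proof -
  obtain d where d: "0 < d" "ball 0 d \<subseteq> U"
    using assms open_contains_ball by blast
  \<comment> \<open>The Euclidean norm is at most the sum of the moduli of the coordinates, and
    there are \<open>CARD('n)\<close> of them.\<close>
  define r where "r = d / real CARD('n)"
  have "norm x < d" if "x \<in> polydisc r" for x :: "complex^'n"
  proof -
    have "norm x \<le> (\<Sum>i\<in>UNIV. norm (x $ i))"
      unfolding norm_vec_def by (rule L2_set_le_sum) simp
    also have "\<dots> < (\<Sum>i\<in>(UNIV::'n set). r)"
      using that by (intro sum_strict_mono) (auto simp: polydisc_def)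
    also have "\<dots> = d" by (simp add: r_def)
    finally show ?thesis .
  qed
  with d have "polydisc r \<subseteq> U" by (auto simp: subset_iff)
  moreover have "0 < r" using d by (simp add: r_def)
  ultimately show ?thesis using that by blast
qed

lemma has_derivative_vecI:
  fixes f :: "'a::euclidean_space \<Rightarrow> complex^'n::finite"
  assumes "\<And>i. ((\<lambda>x. f x $ i) has_derivative (\<lambda>h. f' h $ i)) (at a within S)"
  shows "(f has_derivative f') (at a within S)"
proof (subst has_derivative_componentwise_within, intro ballI)
  fix b :: "complex^'n" assume "b \<in> Basis"
  then obtain i c where b: "b = axis i c" by (auto simp: Basis_vec_def)
  show "((\<lambda>x. f x \<bullet> b) has_derivative (\<lambda>x. f' x \<bullet> b)) (at a within S)"
    unfolding b inner_axis by (intro has_derivative_inner_left assms)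
qed

section \<open>Closure properties of holomorphic functions\<close>

lemma hol_on_subset: "hol_on u U \<Longrightarrow> V \<subseteq> U \<Longrightarrow> hol_on u V"
  by (auto simp: hol_on_def)

lemma hol_on_cong:
  assumes "open U" "\<And>x. x \<in> U \<Longrightarrow> u x = v x"
  shows "hol_on u U \<longleftrightarrow> hol_on v U"
proof -
  have *: "hol_on v U" if "hol_on u U" "\<And>x. x \<in> U \<Longrightarrow> u x = v x" for u v
    unfolding hol_on_def
  proof
    fix x assume x: "x \<in> U"
    then obtain D where D: "(u has_derivative D) (at x)" "\<forall>c h. D (c *s h) = c * D h"
      using \<open>hol_on u U\<close> by (auto simp: hol_on_def)
    then show "\<exists>D. (v has_derivative D) (at x) \<and> (\<forall>c h. D (c *s h) = c * D h)"
      using has_derivative_transform_within_open[OF D(1) \<open>open U\<close> x that(2)] by blast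
  qed
  show ?thesis using *[of u v] *[of v u] assms(2) by metis
qed

lemma hol_on_imp_continuous_on: "hol_on u U \<Longrightarrow> continuous_on U u"
  unfolding hol_on_def
  by (meson continuous_at_imp_continuous_on has_derivative_continuous)

lemma hol_on_const [simp, intro]: "hol_on (\<lambda>x. c) U"
  unfolding hol_on_def by (intro ballI exI[of _ "\<lambda>h. 0"]) auto

lemma hol_on_nth [simp, intro]: "hol_on (\<lambda>x. x $ i) U"
  unfolding hol_on_def
  by (intro ballI exI[of _ "\<lambda>h. h $ i"] conjI bounded_linear.has_derivative[OF bounded_linear_vec_nth]) auto

lemma hol_on_add [intro]: "hol_on u U \<Longrightarrow> hol_on v U \<Longrightarrow> hol_on (\<lambda>x. u x + v x) U"
  unfolding hol_on_def
proof
  fix x assume "\<forall>x\<in>U. \<exists>D. (u has_derivative D) (at x) \<and> (\<forall>c h. D (c *s h) = c * D h)"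
    "\<forall>x\<in>U. \<exists>D. (v has_derivative D) (at x) \<and> (\<forall>c h. D (c *s h) = c * D h)" "x \<in> U"
  then obtain D E where "(u has_derivative D) (at x)" "\<forall>c h. D (c *s h) = c * D h"
    "(v has_derivative E) (at x)" "\<forall>c h. E (c *s h) = c * E h" by meson
  then show "\<exists>D. ((\<lambda>x. u x + v x) has_derivative D) (at x) \<and> (\<forall>c h. D (c *s h) = c * D h)"
    by (intro exI[of _ "\<lambda>h. D h + E h"] conjI has_derivative_add) (auto simp: algebra_simps)
qed

lemma hol_on_mult [intro]: "hol_on u U \<Longrightarrow> hol_on v U \<Longrightarrow> hol_on (\<lambda>x. u x * v x) U"
  unfolding hol_on_def
proof
  fix x assume "\<forall>x\<in>U. \<exists>D. (u has_derivative D) (at x) \<and> (\<forall>c h. D (c *s h) = c * D h)"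
    "\<forall>x\<in>U. \<exists>D. (v has_derivative D) (at x) \<and> (\<forall>c h. D (c *s h) = c * D h)" "x \<in> U"
  then obtain D E where "(u has_derivative D) (at x)" "\<forall>c h. D (c *s h) = c * D h"
    "(v has_derivative E) (at x)" "\<forall>c h. E (c *s h) = c * E h" by meson
  then show "\<exists>D. ((\<lambda>x. u x * v x) has_derivative D) (at x) \<and> (\<forall>c h. D (c *s h) = c * D h)"
    by (intro exI[of _ "\<lambda>h. u x * E h + D h * v x"] conjI has_derivative_mult) (auto simp: algebra_simps)
qed

lemma hol_on_uminus [intro]: "hol_on u U \<Longrightarrow> hol_on (\<lambda>x. - u x) U"
  using hol_on_mult[of "\<lambda>x. -1" U u] by auto

lemma hol_on_diff [intro]: "hol_on u U \<Longrightarrow> hol_on v U \<Longrightarrow> hol_on (\<lambda>x. u x - v x) U"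
  using hol_on_add[of u U "\<lambda>x. - v x"] by auto

lemma hol_on_power [intro]: "hol_on u U \<Longrightarrow> hol_on (\<lambda>x. u x ^ n) U"
  by (induction n) auto

lemma hol_on_compose:
  fixes f :: "complex^'n::finite \<Rightarrow> complex^'p::finite"
  assumes "hol_on u V" "\<And>i. hol_on (\<lambda>x. f x $ i) U" "\<And>x. x \<in> U \<Longrightarrow> f x \<in> V"
  shows "hol_on (\<lambda>x. u (f x)) U"
  unfolding hol_on_def
proof
  fix x assume x: "x \<in> U"
  obtain D where D: "(u has_derivative D) (at (f x))" "\<forall>c h. D (c *s h) = c * D h"
    using assms(1) assms(3)[OF x] unfolding hol_on_def by blast
  have "\<forall>i. \<exists>E. ((\<lambda>x. f x $ i) has_derivative E) (at x) \<and> (\<forall>c h. E (c *s h) = c * E h)"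
    using assms(2) x by (auto simp: hol_on_def)
  then obtain E where E: "\<And>i. ((\<lambda>x. f x $ i) has_derivative E i) (at x)"
    "\<And>i c h. E i (c *s h) = c * E i h" by metis
  have f: "(f has_derivative (\<lambda>h. \<chi> i. E i h)) (at x)"
    by (rule has_derivative_vecI) (simp add: E)
  have "((\<lambda>x. u (f x)) has_derivative (\<lambda>h. D (\<chi> i. E i h))) (at x)"
    using has_derivative_compose[OF f D(1)] .
  moreover have "D (\<chi> i. E i (c *s h)) = c * D (\<chi> i. E i h)" for c h
  proof -
    have "(\<chi> i. E i (c *s h)) = c *s (\<chi> i. E i h)"
      by (simp add: vec_eq_iff E)
    then show ?thesis using D by simp
  qed
  ultimately show "\<exists>D. ((\<lambda>x. u (f x)) has_derivative D) (at x) \<and> (\<forall>c h. D (c *s h) = c * D h)"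
    by blast
qed

lemma holomorphic_hol_on_compose:
  assumes "g holomorphic_on B" "open B" "hol_on u U" "\<And>x. x \<in> U \<Longrightarrow> u x \<in> B"
  shows "hol_on (\<lambda>x. g (u x)) U"
  unfolding hol_on_def
proof
  fix x assume x: "x \<in> U"
  then obtain D where D: "(u has_derivative D) (at x)" "\<forall>c h. D (c *s h) = c * D h"
    using assms by (auto simp: hol_on_def)
  have "(g has_field_derivative deriv g (u x)) (at (u x))"
    using assms x by (meson holomorphic_derivI)
  then have "(g has_derivative (\<lambda>z. deriv g (u x) * z)) (at (u x))"
    by (simp add: has_field_derivative_def)
  from has_derivative_compose[OF D(1) this] D(2)
  show "\<exists>D. ((\<lambda>x. g (u x)) has_derivative D) (at x) \<and> (\<forall>c h. D (c *s h) = c * D h)"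
    by (intro exI[of _ "\<lambda>h. deriv g (u x) * D h"]) auto
qed

lemma has_derivative_complex_vecI:
  fixes f :: "complex \<Rightarrow> complex^'n::finite"
  assumes "\<And>i. ((\<lambda>z. f z $ i) has_field_derivative d $ i) (at a within S)"
  shows "(f has_derivative (\<lambda>h. h *s d)) (at a within S)"
  using assms by (intro has_derivative_vecI) (simp add: has_field_derivative_def mult_commute_abs)

lemma hol_on_compose_complex:
  fixes f :: "complex \<Rightarrow> complex^'n::finite"
  assumes "hol_on u U" "\<And>i. (\<lambda>z. f z $ i) holomorphic_on A" "open A" "\<And>z. z \<in> A \<Longrightarrow> f z \<in> U"
  shows "(\<lambda>z. u (f z)) holomorphic_on A"
  unfolding holomorphic_on_open[OF \<open>open A\<close>]
proof
  fix z assume z: "z \<in> A"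
  then obtain D where D: "(u has_derivative D) (at (f z))" "\<forall>c h. D (c *s h) = c * D h"
    using assms(1,4) unfolding hol_on_def by blast
  define d :: "complex^'n" where "d = (\<chi> i. deriv (\<lambda>z. f z $ i) z)"
  have "(f has_derivative (\<lambda>h. h *s d)) (at z)"
    using assms(2,3) z by (intro has_derivative_complex_vecI) (auto simp: d_def intro: holomorphic_derivI)
  from has_derivative_compose[OF this D(1)] D(2)
  have "((\<lambda>z. u (f z)) has_derivative (\<lambda>h. h * D d)) (at z)"
    by simp
  then have "((\<lambda>z. u (f z)) has_field_derivative D d) (at z)"
    by (simp add: has_field_derivative_def mult_commute_abs)
  then show "\<exists>f'. ((\<lambda>z. u (f z)) has_field_derivative f') (at z)" ..
qed

section \<open>Slices in one variable and the complex gradient\<close>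

lemma hol_on_slice:
  fixes u :: "complex^'n::finite \<Rightarrow> complex"
  assumes "hol_on u (polydisc r)" "x \<in> polydisc r"
  shows "(\<lambda>z. u (vupd x s z)) holomorphic_on ball 0 r"
proof (rule hol_on_compose_complex[OF assms(1)])
  show "(\<lambda>z. vupd x s z $ i) holomorphic_on ball 0 r" for i
    by (cases "i = s") (auto intro: holomorphic_intros)
qed (use assms(2) in \<open>auto simp: polydisc_def\<close>)

text \<open>Expanding \<open>h\<close> in the standard basis and using complex homogeneity,
  \<open>D\<close> is determined by the values \<open>D (axis s 1)\<close>, and these are the
  derivatives of the slices through \<open>x\<close>.\<close>

lemma hol_on_has_partial_deriv:
  fixes u :: "complex^'n::finite \<Rightarrow> complex"
  assumes "hol_on u U" "x \<in> U"
  shows "(u has_derivative (\<lambda>h. \<Sum>s\<in>UNIV. partial_deriv s u x * h $ s)) (at x)"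
    and "((\<lambda>z. u (vupd x s z)) has_field_derivative partial_deriv s u x) (at (x $ s))"
proof -
  obtain D where D: "(u has_derivative D) (at x)" "\<And>c h. D (c *s h) = c * D h"
    using assms by (auto simp: hol_on_def)
  have lin: "linear D" using D(1) has_derivative_linear by blast
  have upd: "((\<lambda>z. u (vupd x s z)) has_field_derivative D (axis s 1)) (at (x $ s))" for s
  proof -
    have "(vupd x s has_derivative (\<lambda>h. h *s axis s 1)) (at (x $ s))"
    proof (rule has_derivative_complex_vecI)
      show "((\<lambda>z. vupd x s z $ i) has_field_derivative axis s 1 $ i) (at (x $ s))" for i
        by (cases "i = s") (auto simp: axis_def)
    qed
    moreover have "(u has_derivative D) (at (vupd x s (x $ s)))" using D(1) by simp
    ultimately have "((\<lambda>z. u (vupd x s z)) has_derivative (\<lambda>h. D (h *s axis s 1))) (at (x $ s))"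
      by (rule has_derivative_compose)
    then show ?thesis by (simp add: has_field_derivative_def D(2) mult_commute_abs)
  qed
  have pd: "partial_deriv s u x = D (axis s 1)" for s
  proof -
    have eq: "x + axis s t = vupd x s (x $ s + t)" for t
      by (auto simp: vec_eq_iff axis_def)
    have "((\<lambda>t. u (x + axis s t)) has_field_derivative D (axis s 1)) (at 0)"
      unfolding eq using upd[of s] DERIV_shift[of "\<lambda>z. u (vupd x s z)" _ 0 "x $ s"]
      by (simp add: add.commute)
    then show ?thesis unfolding partial_deriv_def by (rule DERIV_imp_deriv)
  qed
  have "D h = (\<Sum>s\<in>UNIV. partial_deriv s u x * h $ s)" for h
  proof -
    have "D h = D (\<Sum>s\<in>UNIV. h $ s *s axis s 1)" by (simp add: basis_expansion)
    also have "\<dots> = (\<Sum>s\<in>UNIV. h $ s * D (axis s 1))"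
      by (simp add: linear_sum[OF lin] D(2))
    finally show ?thesis by (simp add: pd mult.commute)
  qed
  then have "D = (\<lambda>h. \<Sum>s\<in>UNIV. partial_deriv s u x * h $ s)" by (rule ext)
  with D(1) show "(u has_derivative (\<lambda>h. \<Sum>s\<in>UNIV. partial_deriv s u x * h $ s)) (at x)" by simp
  show "((\<lambda>z. u (vupd x s z)) has_field_derivative partial_deriv s u x) (at (x $ s))"
    using upd pd by simp
qed

section \<open>Cauchy integrals\<close>

lemma polydisc_shrink:
  fixes x :: "complex^'n::finite"
  assumes "x \<in> polydisc r"
  obtains r' where "0 < r'" "r' < r" "x \<in> polydisc r'"
proof -
  \<comment> \<open>Inserting \<open>0\<close> makes \<open>M\<close> nonnegative, so that
    \<open>r'\<close> is positive.\<close>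
  define M where "M = Max (insert 0 (range (\<lambda>i. norm (x $ i))))"
  have "0 < r"
    using assms le_less_trans[OF norm_ge_zero] unfolding polydisc_def by blast
  then have "M < r"
    unfolding M_def using assms by (subst Max_less_iff) (auto simp: polydisc_def)
  then obtain r' where r': "M < r'" "r' < r"
    using dense by blast
  have "a < r'" if "a \<in> insert 0 (range (\<lambda>i. norm (x $ i)))" for a
    using r'(1) that unfolding M_def by (subst (asm) Max_less_iff) auto
  then have "0 < r'" "x \<in> polydisc r'"
    by (auto simp: polydisc_def)
  with r' show ?thesis by (intro that)
qed

text \<open>A circle around \<open>0\<close> satisfies \<open>c' = 2 pi i c\<close>. Cauchy
  integrals thus become integrals over the unit interval, to which the theorems on integrals with
  parameters apply.\<close>

lemma contour_integral_circlepath_0: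
  "contour_integral (circlepath 0 r) f =
     2 * of_real pi * \<i> * integral {0..1} (\<lambda>t. f (circlepath 0 r t) * circlepath 0 r t)"
proof -
  have "contour_integral (circlepath 0 r) f =
      integral {0..1} (\<lambda>t. 2 * of_real pi * \<i> * (f (circlepath 0 r t) * circlepath 0 r t))"
    unfolding contour_integral_integral
  proof (rule integral_cong)
    fix t :: real assume "t \<in> {0..1}"
    then show "f (circlepath 0 r t) * vector_derivative (circlepath 0 r) (at t) =
        2 * of_real pi * \<i> * (f (circlepath 0 r t) * circlepath 0 r t)"
      by (subst vector_derivative_circlepath) (auto simp: circlepath)
  qed
  then show ?thesis by (simp only: integral_mult_right)
qed

lemma norm_circlepath_0: "0 \<le> r \<Longrightarrow> norm (circlepath 0 r t) = r"
  by (simp add: circlepath norm_mult)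

lemma continuous_on_circlepath_0 [continuous_intros]:
  "continuous_on S g \<Longrightarrow> continuous_on S (\<lambda>x. circlepath 0 r (g x))"
  unfolding circlepath by (intro continuous_intros)

lemma continuous_on_vupd [continuous_intros]:
  fixes f :: "'a::topological_space \<Rightarrow> complex^'n::finite"
  assumes "continuous_on S f" "continuous_on S g"
  shows "continuous_on S (\<lambda>x. vupd (f x) s (g x))"
  unfolding vupd_def
proof (rule continuous_on_vec_lambda)
  show "continuous_on S (\<lambda>x. if i = s then g x else f x $ i)" for i
    using assms by (cases "i = s") (auto intro!: continuous_intros)
qed

lemma hol_on_vupd:
  fixes u :: "complex^'n::finite \<Rightarrow> complex"
  assumes "hol_on u (polydisc r)" "hol_on g (polydisc r')" "r' \<le> r"
    "\<And>x. x \<in> polydisc r' \<Longrightarrow> norm (g x) < r"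
  shows "hol_on (\<lambda>x. u (vupd x s (g x))) (polydisc r')"
proof (rule hol_on_compose[OF assms(1)])
  show "hol_on (\<lambda>x. vupd x s (g x) $ i) (polydisc r')" for i
    using assms(2) by (cases "i = s") auto
next
  fix x :: "complex^'n" assume "x \<in> polydisc r'"
  then show "vupd x s (g x) \<in> polydisc r"
    using assms(3,4) by (auto simp: polydisc_def intro: less_le_trans)
qed

text \<open>These are the Cauchy formulas for the slice in direction \<open>s\<close>; the other
  coordinates are parameters. The trailing factor \<open>circlepath 0 r' t\<close> is what remains
  of \<open>dz\<close> once \<open>2 pi i\<close> has cancelled.\<close>

lemma hol_on_Cauchy:
  fixes u :: "complex^'n::finite \<Rightarrow> complex"
  assumes u: "hol_on u (polydisc r)" and r': "0 < r'" "r' < r" and x: "x \<in> polydisc r'"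
  shows "u x = integral {0..1} (\<lambda>t. u (vupd x s (circlepath 0 r' t)) /
                 (circlepath 0 r' t - x $ s) * circlepath 0 r' t)"
    and "partial_deriv s u x = integral {0..1} (\<lambda>t. u (vupd x s (circlepath 0 r' t)) /
                 (circlepath 0 r' t - x $ s)\<^sup>2 * circlepath 0 r' t)"
proof -
  have xr: "x \<in> polydisc r" using x r' polydisc_mono[of r' r] by auto
  have hol: "(\<lambda>z. u (vupd x s z)) holomorphic_on cball 0 r'"
    by (rule holomorphic_on_subset[OF hol_on_slice[OF u xr]]) (use r' in auto)
  have w: "x $ s \<in> ball 0 r'" using x by (simp add: polydisc_def)
  have "contour_integral (circlepath 0 r') (\<lambda>z. u (vupd x s z) / (z - x $ s)) =
      2 * of_real pi * \<i> * u (vupd x s (x $ s))"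
    by (rule contour_integral_unique[OF Cauchy_integral_circlepath_simple[OF hol]]) (use w in auto)
  then show "u x = integral {0..1} (\<lambda>t. u (vupd x s (circlepath 0 r' t)) /
                 (circlepath 0 r' t - x $ s) * circlepath 0 r' t)"
    by (simp add: contour_integral_circlepath_0)
  have "((\<lambda>z. u (vupd x s z)) has_field_derivative
      1 / (2 * of_real pi * \<i>) * contour_integral (circlepath 0 r') (\<lambda>z. u (vupd x s z) / (z - x $ s)\<^sup>2)) (at (x $ s))"
    using hol w by (intro Cauchy_derivative_integral_circlepath)
      (auto intro: holomorphic_on_imp_continuous_on holomorphic_on_subset)
  from DERIV_unique[OF this hol_on_has_partial_deriv(2)[OF u xr]]
  show "partial_deriv s u x = integral {0..1} (\<lambda>t. u (vupd x s (circlepath 0 r' t)) /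
                 (circlepath 0 r' t - x $ s)\<^sup>2 * circlepath 0 r' t)"
    by (simp add: contour_integral_circlepath_0)
qed

text \<open>Cauchy's formula expresses the partial derivative by values of \<open>f\<close> on a
  circle, and an integral over a compact interval depends continuously on the parameters of a
  continuous integrand.\<close>

lemma continuous_on_partial_deriv_param:
  fixes f :: "complex^'n::finite \<Rightarrow> 'b::t2_space \<Rightarrow> complex"
  assumes cont: "continuous_on (polydisc r \<times> T) (\<lambda>(x, t). f x t)"
    and hol: "\<And>t. t \<in> T \<Longrightarrow> hol_on (\<lambda>x. f x t) (polydisc r)"
  shows "continuous_on (polydisc r \<times> T) (\<lambda>(x, t). partial_deriv s (\<lambda>x. f x t) x)"
  unfolding continuous_on_eq_continuous_within
proof
  fix p :: "(complex^'n) \<times> 'b" assume p: "p \<in> polydisc r \<times> T"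
  then obtain r' where r': "0 < r'" "r' < r" "fst p \<in> polydisc r'"
    using polydisc_shrink by (metis mem_Times_iff)
  let ?c = "circlepath 0 r'"
  have nz: "?c t \<noteq> x $ s" if "x \<in> polydisc r'" for x :: "complex^'n" and t
    using that r' norm_circlepath_0[of r' t] by (auto simp: polydisc_def)
  have "continuous_on ((polydisc r' \<times> T) \<times> cbox 0 1)
      (\<lambda>(p, \<theta>). (\<lambda>(x, t) \<theta>. f (vupd x s (?c \<theta>)) t / (?c \<theta> - x $ s)\<^sup>2 * ?c \<theta>) p \<theta>)"
  proof -
    have "continuous_on ((polydisc r' \<times> T) \<times> cbox 0 1)
        (\<lambda>q. (\<lambda>(x, t). f x t) (vupd (fst (fst q)) s (?c (snd q)), snd (fst q)))"
    proof (rule continuous_on_compose2[OF cont])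
      show "(\<lambda>q. (vupd (fst (fst q)) s (?c (snd q)), snd (fst q))) ` ((polydisc r' \<times> T) \<times> cbox 0 1)
          \<subseteq> polydisc r \<times> T"
        using r' by (fastforce simp: polydisc_def norm_circlepath_0 intro: less_trans)
    qed (intro continuous_intros)
    then have "continuous_on ((polydisc r' \<times> T) \<times> cbox 0 1)
        (\<lambda>q. f (vupd (fst (fst q)) s (?c (snd q))) (snd (fst q)) / (?c (snd q) - fst (fst q) $ s)\<^sup>2 * ?c (snd q))"
      by (intro continuous_intros) (auto simp: nz)
    then show ?thesis by (simp add: case_prod_unfold)
  qed
  from integral_continuous_on_param[OF this]
  have "continuous_on (polydisc r' \<times> T) (\<lambda>(x, t). partial_deriv s (\<lambda>x. f x t) x)"
  proof (rule continuous_on_eq)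
    fix q :: "(complex^'n) \<times> 'b" assume q: "q \<in> polydisc r' \<times> T"
    have "partial_deriv s (\<lambda>x. f x (snd q)) (fst q) =
        integral {0..1} (\<lambda>\<theta>. f (vupd (fst q) s (?c \<theta>)) (snd q) / (?c \<theta> - fst q $ s)\<^sup>2 * ?c \<theta>)"
      using q r' by (intro hol_on_Cauchy(2)[OF hol]) auto
    then show "integral (cbox 0 1) ((\<lambda>(x, t) \<theta>. f (vupd x s (?c \<theta>)) t / (?c \<theta> - x $ s)\<^sup>2 * ?c \<theta>) q) =
        (case q of (x, t) \<Rightarrow> partial_deriv s (\<lambda>x. f x t) x)"
      by (simp add: case_prod_unfold)
  qed
  moreover have p': "p \<in> polydisc r' \<times> T" using p r' by (simp add: mem_Times_iff)
  ultimately have "continuous (at p within polydisc r' \<times> T) (\<lambda>(x, t). partial_deriv s (\<lambda>x. f x t) x)"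
    unfolding continuous_on_eq_continuous_within by (rule bspec)
  \<comment> \<open>Continuity is local and \<open>polydisc r'\<close> is an open neighbourhood of
    the point, so the smaller radius can be replaced by \<open>r\<close>.\<close>
  also have "at p within polydisc r' \<times> T = at p within polydisc r \<times> T"
  proof (rule at_within_nhd[of _ "polydisc r' \<times> UNIV"])
    show "polydisc r' \<times> T \<inter> polydisc r' \<times> UNIV - {p} = polydisc r \<times> T \<inter> polydisc r' \<times> UNIV - {p}"
      using polydisc_mono[OF less_imp_le[OF r'(2)], where 'a = 'n] by auto
    show "p \<in> polydisc r' \<times> UNIV" using p' by (simp add: mem_Times_iff)
    show "open (polydisc r' \<times> UNIV :: ((complex^'n) \<times> 'b) set)"
      by (rule open_Times) auto
  qed
  finally show "continuous (at p within polydisc r \<times> T) (\<lambda>(x, t). partial_deriv s (\<lambda>x. f x t) x)" .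
qed

lemma continuous_on_partial_deriv:
  fixes u :: "complex^'n::finite \<Rightarrow> complex"
  assumes "hol_on u (polydisc r)"
  shows "continuous_on (polydisc r) (partial_deriv s u)"
proof -
  \<comment> \<open>A parameter set with one point reduces the claim to the parametric
    version.\<close>
  have "continuous_on (polydisc r \<times> {0::real}) (\<lambda>(x, t). partial_deriv s u x)"
  proof (rule continuous_on_partial_deriv_param[where f = "\<lambda>x t. u x"])
    show "continuous_on (polydisc r \<times> {0::real}) (\<lambda>(x, t). u x)"
      unfolding case_prod_unfold
      by (rule continuous_on_compose2[OF hol_on_imp_continuous_on[OF assms]])
         (auto intro: continuous_intros)
  qed (rule assms)
  then have "continuous_on (polydisc r) (\<lambda>x. (\<lambda>(x, t). partial_deriv s u x) (x, 0::real))"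
    by (rule continuous_on_compose2[where f = "\<lambda>x. (x, 0::real)"]) (auto intro!: continuous_intros)
  then show ?thesis by simp
qed

text \<open>The derivative as an element of the normed space of bounded operators, the form in which
  the Leibniz rule and the inverse function theorem ask for its continuity.\<close>

definition gradient_blinfun :: "('n \<Rightarrow> complex) \<Rightarrow> (complex^'n::finite) \<Rightarrow>\<^sub>L complex" where
  "gradient_blinfun c = (\<Sum>s\<in>UNIV. blinfun_mult_right (c s) o\<^sub>L Blinfun (\<lambda>h. h $ s))"

lemma gradient_blinfun_apply: "blinfun_apply (gradient_blinfun c) = (\<lambda>h. \<Sum>s\<in>UNIV. c s * h $ s)"
  by (rule ext) (simp add: gradient_blinfun_def blinfun.sum_left
    bounded_linear_Blinfun_apply[OF bounded_linear_vec_nth])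

lemma continuous_on_gradient_blinfun:
  "(\<And>s. continuous_on S (\<lambda>x. c x s)) \<Longrightarrow> continuous_on S (\<lambda>x. gradient_blinfun (c x))"
  unfolding gradient_blinfun_def
  by (intro continuous_intros bounded_linear.continuous_on[OF bounded_linear_blinfun_mult_right])

text \<open>The Leibniz rule gives a real derivative, namely the integral of the gradients. It is
  complex linear because scalars can be moved through the integral.\<close>

lemma hol_on_integral:
  fixes f :: "complex^'n::finite \<Rightarrow> real \<Rightarrow> complex"
  assumes cont: "continuous_on (polydisc r \<times> {0..1}) (\<lambda>(x, t). f x t)"
    and hol: "\<And>t. t \<in> {0..1} \<Longrightarrow> hol_on (\<lambda>x. f x t) (polydisc r)"
  shows "hol_on (\<lambda>x. integral {0..1} (f x)) (polydisc r)"
proof -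
  define G where "G x t = gradient_blinfun (\<lambda>s. partial_deriv s (\<lambda>x. f x t) x)" for x t
  have contG: "continuous_on (polydisc r \<times> {0..1}) (\<lambda>(x, t). G x t)"
    using continuous_on_partial_deriv_param[OF cont hol]
    unfolding G_def case_prod_unfold by (intro continuous_on_gradient_blinfun) auto
  have intf: "f x integrable_on cbox 0 1" if "x \<in> polydisc r" for x
  proof -
    have "continuous_on {0..1} (\<lambda>t. (\<lambda>(x, t). f x t) (x, t))"
      using that by (intro continuous_on_compose2[OF cont]) (auto intro!: continuous_intros)
    then show ?thesis by (auto intro: integrable_continuous_interval)
  qed
  have der: "((\<lambda>x. integral {0..1} (f x)) has_derivative integral {0..1} (G x)) (at x)"
    if x: "x \<in> polydisc r" for x
  proof -
    have "((\<lambda>x. integral (cbox 0 1) (f x)) has_derivative integral (cbox 0 1) (G x)) (at x within polydisc r)"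
    proof (rule leibniz_rule)
      show "((\<lambda>x. f x t) has_derivative blinfun_apply (G x t)) (at x within polydisc r)"
        if "x \<in> polydisc r" "t \<in> cbox 0 1" for x t
        using hol_on_has_partial_deriv(1)[OF hol that(1)] that(2)
        unfolding G_def gradient_blinfun_apply by (auto intro: has_derivative_at_withinI)
    qed (use contG intf x in auto)
    then show ?thesis using x by (simp add: at_within_open[OF _ open_polydisc])
  qed
  show ?thesis unfolding hol_on_def
  proof
    fix x :: "complex^'n" assume x: "x \<in> polydisc r"
    have int: "G x integrable_on {0..1}"
    proof -
      have "continuous_on {0..1} (\<lambda>t. (\<lambda>(x, t). G x t) (x, t))"
        using x by (intro continuous_on_compose2[OF contG]) (auto intro!: continuous_intros)
      then show ?thesis by (auto intro: integrable_continuous_interval)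
    qed
    have "blinfun_apply (integral {0..1} (G x)) (c *s h) = c * blinfun_apply (integral {0..1} (G x)) h" for c h
      unfolding blinfun_apply_integral[OF int]
      by (simp add: G_def gradient_blinfun_apply sum_distrib_left mult_ac flip: integral_mult_right)
    with der[OF x] show "\<exists>D. ((\<lambda>x. integral {0..1} (f x)) has_derivative D) (at x) \<and> (\<forall>c h. D (c *s h) = c * D h)"
      by blast
  qed
qed

text \<open>The coordinate \<open>x $ s\<close> enters only through the kernel \<open>k\<close>, so
  its domain has a radius \<open>r2\<close> of its own. The kernel \<open>z / (z - w)^2\<close>
  gives partial derivatives, and \<open>z^(m-b) / (z^m - w)\<close> gives the coefficients of
  Weierstrass division.\<close>

lemma hol_on_Cauchy_type_integral:
  fixes u :: "complex^'n::finite \<Rightarrow> complex" and k :: "complex \<Rightarrow> complex \<Rightarrow> complex"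
  assumes u: "hol_on u (polydisc r)" and r: "0 < r1" "r1 < r" "r2 \<le> r"
    and k: "continuous_on (sphere 0 r1 \<times> ball 0 r2) (\<lambda>(z, w). k z w)"
    and holk: "\<And>z. norm z = r1 \<Longrightarrow> k z holomorphic_on ball 0 r2"
  shows "hol_on (\<lambda>x. integral {0..1} (\<lambda>t. u (vupd x s (circlepath 0 r1 t)) *
            k (circlepath 0 r1 t) (x $ s))) (polydisc r2)"
proof (rule hol_on_integral)
  let ?c = "circlepath 0 r1"
  have "continuous_on (polydisc r2 \<times> {0..1}) (\<lambda>p. u (vupd (fst p) s (?c (snd p))))"
  proof (rule continuous_on_compose2[OF hol_on_imp_continuous_on[OF u]])
    show "(\<lambda>p. vupd (fst p) s (?c (snd p))) ` (polydisc r2 \<times> {0..1}) \<subseteq> polydisc r"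
      using r by (fastforce simp: polydisc_def norm_circlepath_0 intro: less_le_trans)
  qed (intro continuous_intros)
  moreover have "continuous_on (polydisc r2 \<times> {0..1}) (\<lambda>p. (\<lambda>(z, w). k z w) (?c (snd p), fst p $ s))"
    using r by (intro continuous_on_compose2[OF k])
       (auto simp: polydisc_def norm_circlepath_0 intro!: continuous_intros)
  ultimately show "continuous_on (polydisc r2 \<times> {0..1}) (\<lambda>(x, t). u (vupd x s (?c t)) * k (?c t) (x $ s))"
    by (auto simp: case_prod_unfold intro!: continuous_intros)
  show "hol_on (\<lambda>x. u (vupd x s (?c t)) * k (?c t) (x $ s)) (polydisc r2)" for t
    using r by (intro hol_on_mult hol_on_vupd[OF u] holomorphic_hol_on_compose[OF holk])
       (auto simp: norm_circlepath_0 polydisc_def)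
qed

text \<open>On each smaller polydisc the derivative is a Cauchy type integral, and the smaller
  polydiscs exhaust \<open>polydisc r\<close>.\<close>

lemma hol_on_partial_deriv:
  fixes u :: "complex^'n::finite \<Rightarrow> complex"
  assumes u: "hol_on u (polydisc r)"
  shows "hol_on (partial_deriv s u) (polydisc r)"
proof -
  have *: "hol_on (partial_deriv s u) (polydisc r')" if r': "0 < r'" "r' < r" for r'
  proof -
    have nz: "norm z = r' \<Longrightarrow> norm w < r' \<Longrightarrow> z \<noteq> w" for z w :: complex by auto
    have "hol_on (\<lambda>x. integral {0..1} (\<lambda>t. u (vupd x s (circlepath 0 r' t)) *
              (circlepath 0 r' t / (circlepath 0 r' t - x $ s)\<^sup>2))) (polydisc r')"
      using r' by (intro hol_on_Cauchy_type_integral[OF u, where k = "\<lambda>z w. z / (z - w)\<^sup>2"])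
        (auto simp: case_prod_unfold nz intro!: continuous_intros holomorphic_intros)
    moreover have "partial_deriv s u x = integral {0..1} (\<lambda>t. u (vupd x s (circlepath 0 r' t)) *
              (circlepath 0 r' t / (circlepath 0 r' t - x $ s)\<^sup>2))" if "x \<in> polydisc r'" for x
      using hol_on_Cauchy(2)[OF u r' that, of s] by simp
    ultimately show ?thesis
      by (subst hol_on_cong[OF open_polydisc])
  qed
  show ?thesis
    unfolding hol_on_def
  proof
    fix x :: "complex^'n" assume "x \<in> polydisc r"
    then obtain r' where "0 < r'" "r' < r" "x \<in> polydisc r'"
      by (rule polydisc_shrink)
    then show "\<exists>D. (partial_deriv s u has_derivative D) (at x) \<and> (\<forall>c h. D (c *s h) = c * D h)"
      using *[unfolded hol_on_def] by blast
  qed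
qed

section \<open>Residue classes of exponents and zero jets\<close>

lemma vupd_vupd [simp]: "vupd (vupd x s z) s w = vupd x s w"
  by (simp add: vec_eq_iff)

text \<open>The factorization of \<open>z^m - x^m\<close> splits the Cauchy kernel
  \<open>z / (z - x)\<close> according to the exponents of \<open>x\<close> modulo \<open>m\<close>:
  apart from the factors \<open>x^b\<close>, only \<open>x^m\<close> occurs.\<close>

lemma sum_power_mult_power_diff:
  fixes x z :: complex
  assumes "z ^ m \<noteq> x ^ m"
  shows "(\<Sum>b<m. x ^ b * (z ^ (m - b) / (z ^ m - x ^ m))) = z / (z - x)"
proof -
  have "(\<Sum>b<m. x ^ b * z ^ (m - b)) = z * (\<Sum>b<m. z ^ (m - Suc b) * x ^ b)"
    unfolding sum_distrib_left
    by (rule sum.cong) (auto simp: Suc_diff_Suc simp flip: power_Suc)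
  moreover have "(\<Sum>b<m. z ^ (m - Suc b) * x ^ b) * (z - x) = z ^ m - x ^ m"
    using power_diff_sumr2[of x m z] by (simp add: algebra_simps)
  ultimately have "(\<Sum>b<m. x ^ b * z ^ (m - b)) * (z - x) = z * (z ^ m - x ^ m)"
    by (simp only: mult.assoc)
  moreover have "z \<noteq> x" using assms by auto
  ultimately have "(\<Sum>b<m. x ^ b * z ^ (m - b)) / (z ^ m - x ^ m) = z / (z - x)"
    using assms by (simp add: field_simps)
  then show ?thesis by (simp add: sum_divide_distrib)
qed

lemma vupd_power_in_polydisc:
  assumes "x \<in> polydisc r" "r \<le> 1" "0 < m"
  shows "vupd x s (x $ s ^ m) \<in> polydisc r"
proof -
  have "norm (x $ s) < r" using assms by (simp add: polydisc_def)
  moreover have "norm (x $ s) ^ m \<le> norm (x $ s) ^ 1"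
    using calculation assms by (intro power_decreasing) auto
  ultimately have "norm (x $ s) ^ m < r" by simp
  then show ?thesis using assms by (auto simp: polydisc_def norm_power)
qed

text \<open>Weierstrass division by \<open>x\<^sub>s\<^sup>m - w\<close>, with the remainder given by the Cauchy formula.\<close>

lemma hol_on_residue_classes:
  fixes u :: "complex^'n::finite \<Rightarrow> complex"
  assumes u: "hol_on u (polydisc r)" and r: "0 < r" and m: "0 < m"
  shows "\<exists>r' V. 0 < r' \<and> r' \<le> 1 \<and> (\<forall>b. hol_on (V b) (polydisc r')) \<and>
    (\<forall>x\<in>polydisc r'. u x = (\<Sum>b<m. x $ s ^ b * V b (vupd x s (x $ s ^ m))))"
proof -
  \<comment> \<open>A radius below \<open>1\<close> ensures that \<open>r1 ^ m\<close> does not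
    exceed \<open>r1\<close>.\<close>
  define r1 where "r1 = min (r / 2) (1 / 2)"
  have r1: "0 < r1" "r1 < r" "r1 < 1" using r by (auto simp: r1_def)
  \<comment> \<open>On the circle of radius \<open>r1\<close> the power \<open>z^m\<close> has
    modulus \<open>r1^m\<close>, so \<open>z^m - w\<close> has no zero there for \<open>w\<close> of
    modulus below \<open>r'\<close>.\<close>
  define r' where "r' = r1 ^ m"
  have r'1: "r' \<le> r1" using power_decreasing[of 1 m r1] r1 m by (simp add: r'_def)
  have r': "0 < r'" "r' \<le> 1" "r' \<le> r" using r1 r'1 by (auto simp: r'_def)
  let ?c = "circlepath 0 r1"
  \<comment> \<open>The coefficient of \<open>x^b\<close> in the split Cauchy kernel, with
    \<open>x^m\<close> replaced by an independent variable.\<close>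
  define V where "V b x = integral {0..1} (\<lambda>t. u (vupd x s (?c t)) * (?c t ^ (m - b) / (?c t ^ m - x $ s)))"
    for b x
  have nz: "z ^ m \<noteq> w" if "norm z = r1" "norm w < r'" for z w :: complex
    using that by (auto simp: norm_power r'_def)
  have "hol_on (V b) (polydisc r')" for b
    unfolding V_def using r1 r' nz
    by (intro hol_on_Cauchy_type_integral[OF u, where k = "\<lambda>z w. z ^ (m - b) / (z ^ m - w)"])
       (auto simp: case_prod_unfold intro!: continuous_intros holomorphic_intros)
  moreover have "u x = (\<Sum>b<m. x $ s ^ b * V b (vupd x s (x $ s ^ m)))" if x: "x \<in> polydisc r'" for x
  proof -
    have xs: "norm (x $ s ^ m) < r'"
      using vupd_power_in_polydisc[OF x, of m s] r' m by (auto simp: polydisc_def dest!: spec[of _ s])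
    have nz': "?c t ^ m \<noteq> x $ s ^ m" for t
      using nz[OF _ xs] r1 norm_circlepath_0[of r1 t] by auto
    have cont: "continuous_on {0..1} (\<lambda>t. u (vupd x s (?c t)))"
    proof (rule continuous_on_compose2[OF hol_on_imp_continuous_on[OF u]])
      show "(\<lambda>t. vupd x s (?c t)) ` {0..1} \<subseteq> polydisc r"
        using x r1 r' by (fastforce simp: polydisc_def norm_circlepath_0 intro: less_le_trans)
    qed (intro continuous_intros)
    define g where "g b t = u (vupd x s (?c t)) * (?c t ^ (m - b) / (?c t ^ m - x $ s ^ m))" for b t
    have int: "g b integrable_on {0..1}" for b
      unfolding g_def using nz' by (intro integrable_continuous_interval continuous_intros cont) auto
    have "(\<Sum>b<m. x $ s ^ b * V b (vupd x s (x $ s ^ m))) = (\<Sum>b<m. integral {0..1} (\<lambda>t. x $ s ^ b * g b t))"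
      unfolding integral_mult_right by (simp add: V_def g_def)
    also have "\<dots> = integral {0..1} (\<lambda>t. \<Sum>b<m. x $ s ^ b * g b t)"
      by (rule integral_sum [symmetric]) (auto intro!: integrable_on_mult_right int)
    also have "\<dots> = integral {0..1} (\<lambda>t. u (vupd x s (?c t)) / (?c t - x $ s) * ?c t)"
    proof (rule integral_cong)
      fix t :: real
      have "(\<Sum>b<m. x $ s ^ b * g b t) =
          u (vupd x s (?c t)) * (\<Sum>b<m. x $ s ^ b * (?c t ^ (m - b) / (?c t ^ m - x $ s ^ m)))"
        by (simp add: g_def sum_distrib_left mult_ac)
      then show "(\<Sum>b<m. x $ s ^ b * g b t) = u (vupd x s (?c t)) / (?c t - x $ s) * ?c t"
        unfolding sum_power_mult_power_diff[OF nz'] by simp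
    qed
    also have "\<dots> = u x"
      using hol_on_Cauchy(1)[OF u, of r1 x s] r1 x polydisc_mono[OF r'1] by auto
    finally show ?thesis by simp
  qed
  ultimately show ?thesis using r' by blast
qed

section \<open>Hadamard's lemma and the decomposition of functions with zero jet\<close>

lemma scaleR_in_polydisc:
  assumes "x \<in> polydisc r" "0 \<le> t" "t \<le> 1"
  shows "t *\<^sub>R x \<in> polydisc r"
  unfolding polydisc_def
proof safe
  fix i
  have "norm ((t *\<^sub>R x) $ i) \<le> 1 * norm (x $ i)"
    using assms by (simp add: mult_left_le_one_le)
  also have "\<dots> < r" using assms by (simp add: polydisc_def)
  finally show "norm ((t *\<^sub>R x) $ i) < r" .
qed

lemma continuous_on_hol_on_scaleR:
  assumes "hol_on u (polydisc r)" "x \<in> polydisc r"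
  shows "continuous_on {0..1} (\<lambda>t. u (t *\<^sub>R x))"
  by (rule continuous_on_compose2[OF hol_on_imp_continuous_on[OF assms(1)]])
     (use assms in \<open>auto intro!: continuous_intros scaleR_in_polydisc\<close>)

text \<open>The fundamental theorem of calculus along the segment from \<open>0\<close> to
  \<open>x\<close>.\<close>

lemma hol_on_Hadamard:
  fixes u :: "complex^'n::finite \<Rightarrow> complex"
  assumes u: "hol_on u (polydisc r)" and x: "x \<in> polydisc r" and "u 0 = 0"
  shows "u x = (\<Sum>s\<in>UNIV. x $ s * integral {0..1} (\<lambda>t. partial_deriv s u (t *\<^sub>R x)))"
proof -
  have "((\<lambda>t. \<Sum>s\<in>UNIV. partial_deriv s u (t *\<^sub>R x) * x $ s) has_integral
      u (1 *\<^sub>R x) - u (0 *\<^sub>R x)) {0..1}"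
  proof (rule fundamental_theorem_of_calculus)
    fix t :: real assume t: "t \<in> {0..1}"
    have "((\<lambda>t. t *\<^sub>R x) has_derivative (\<lambda>h. h *\<^sub>R x)) (at t within {0..1})"
      by (auto intro!: derivative_eq_intros)
    from has_derivative_compose[OF this hol_on_has_partial_deriv(1)[OF u scaleR_in_polydisc[OF x]]] t
    have "((\<lambda>t. u (t *\<^sub>R x)) has_derivative
        (\<lambda>h. \<Sum>s\<in>UNIV. partial_deriv s u (t *\<^sub>R x) * (h *\<^sub>R x) $ s)) (at t within {0..1})"
      by auto
    then show "((\<lambda>t. u (t *\<^sub>R x)) has_vector_derivative
        (\<Sum>s\<in>UNIV. partial_deriv s u (t *\<^sub>R x) * x $ s)) (at t within {0..1})"
      by (simp add: has_vector_derivative_def scaleR_sum_right)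
  qed simp
  then have "u x = integral {0..1} (\<lambda>t. \<Sum>s\<in>UNIV. partial_deriv s u (t *\<^sub>R x) * x $ s)"
    using \<open>u 0 = 0\<close> by (simp add: integral_unique)
  also have "\<dots> = (\<Sum>s\<in>UNIV. integral {0..1} (\<lambda>t. partial_deriv s u (t *\<^sub>R x) * x $ s))"
    by (rule integral_sum)
       (auto intro!: integrable_continuous_interval continuous_intros
         continuous_on_hol_on_scaleR[OF hol_on_partial_deriv[OF u] x])
  finally show ?thesis by (simp add: mult.commute)
qed

text \<open>The factor \<open>t^N\<close> arises when a monomial of degree \<open>N\<close> is
  evaluated at \<open>t *\<^sub>R x\<close>.\<close>

lemma hol_on_integral_scaleR:
  fixes v :: "complex^'n::finite \<Rightarrow> complex"
  assumes v: "hol_on v (polydisc r)"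
  shows "hol_on (\<lambda>x. integral {0..1} (\<lambda>t. of_real t ^ N * v (t *\<^sub>R x))) (polydisc r)"
proof (rule hol_on_integral)
  have "continuous_on (polydisc r \<times> {0..1}) (\<lambda>p. v (snd p *\<^sub>R fst p))"
    by (rule continuous_on_compose2[OF hol_on_imp_continuous_on[OF v]])
       (auto intro!: continuous_intros scaleR_in_polydisc)
  then show "continuous_on (polydisc r \<times> {0..1}) (\<lambda>(x, t). of_real t ^ N * v (t *\<^sub>R x))"
    unfolding case_prod_unfold by (intro continuous_intros)
  fix t :: real assume t: "t \<in> {0..1}"
  have "hol_on (\<lambda>x. (t *\<^sub>R x) $ i) (polydisc r)" for i
    using hol_on_mult[OF hol_on_const[of "of_real t"] hol_on_nth[of i "polydisc r"]]
    by (simp add: scaleR_conv_of_real[where 'a = complex])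
  then have "hol_on (\<lambda>x. v (t *\<^sub>R x)) (polydisc r)"
    using t by (intro hol_on_compose[OF v]) (auto intro: scaleR_in_polydisc)
  then show "hol_on (\<lambda>x. of_real t ^ N * v (t *\<^sub>R x)) (polydisc r)"
    by (intro hol_on_mult hol_on_const)
qed

lemma finite_lists_length: "finite {ss :: 'n::finite list. length ss = N}"
  using finite_lists_length_eq[of "UNIV :: 'n set" N] by simp

lemma sum_lists_length_Suc:
  fixes f :: "'n::finite list \<Rightarrow> 'a::comm_monoid_add"
  shows "(\<Sum>ss | length ss = Suc N. f ss) = (\<Sum>s\<in>UNIV. \<Sum>ss | length ss = N. f (s # ss))"
proof -
  have "{ss. length ss = Suc N} = (\<lambda>(s, ss). s # ss) ` (UNIV \<times> {ss :: 'n list. length ss = N})"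
    by (auto simp: length_Suc_conv image_iff)
  then have "(\<Sum>ss | length ss = Suc N. f ss) =
      (\<Sum>p\<in>UNIV \<times> {ss :: 'n list. length ss = N}. f (fst p # snd p))"
    by (simp add: sum.reindex inj_on_def case_prod_unfold)
  then show ?thesis
    by (simp add: sum.cartesian_product case_prod_unfold)
qed

lemma prod_list_scaleR_nth:
  "(\<Prod>s\<leftarrow>ss. (t *\<^sub>R x) $ s) = of_real t ^ length ss * (\<Prod>s\<leftarrow>ss. x $ s :: complex)"
  by (induction ss) (auto simp: scaleR_conv_of_real[where 'a = complex] mult_ac)

text \<open>Hadamard's lemma iterated: the partial derivatives have zero jets of one order less, so
  the induction hypothesis applies to them. Monomials are indexed by words in the variables, as
  derivatives are, so the same monomial may occur for several words.\<close>

lemma hol_on_zero_jet_decomposition: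
  fixes u :: "complex^'n::finite \<Rightarrow> complex"
  assumes "hol_on u (polydisc r)" "0 < r"
    "\<And>ss. length ss < N \<Longrightarrow> iterated_partial_deriv ss u 0 = 0"
  shows "\<exists>v. (\<forall>ss. length ss = N \<longrightarrow> hol_on (v ss) (polydisc r)) \<and>
    (\<forall>x\<in>polydisc r. u x = (\<Sum>ss | length ss = N. (\<Prod>s\<leftarrow>ss. x $ s) * v ss x))"
  using assms
proof (induction N arbitrary: u)
  case 0
  then show ?case by (intro exI[of _ "\<lambda>_. u"]) auto
next
  case (Suc N)
  have "\<exists>v. (\<forall>ss. length ss = N \<longrightarrow> hol_on (v ss) (polydisc r)) \<and>
    (\<forall>x\<in>polydisc r. partial_deriv s u x = (\<Sum>ss | length ss = N. (\<Prod>s\<leftarrow>ss. x $ s) * v ss x))" for s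
  proof (rule Suc.IH[OF hol_on_partial_deriv[OF Suc.prems(1)] Suc.prems(2)])
    fix ss :: "'n list" assume "length ss < N"
    \<comment> \<open>The last letter of a word is the innermost derivative of the
      \<open>foldr\<close>.\<close>
    then show "iterated_partial_deriv ss (partial_deriv s u) 0 = 0"
      using Suc.prems(3)[of "ss @ [s]"] by (simp add: iterated_partial_deriv_def)
  qed
  then obtain v where v: "\<And>s ss. length ss = N \<Longrightarrow> hol_on (v s ss) (polydisc r)"
    and pd: "\<And>s x. x \<in> polydisc r \<Longrightarrow>
      partial_deriv s u x = (\<Sum>ss | length ss = N. (\<Prod>s\<leftarrow>ss. x $ s) * v s ss x)"
    by metis
  \<comment> \<open>The head of the word records the variable split off by Hadamard's lemma, the
    tail the monomial from the induction hypothesis.\<close>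
  define w where "w ss x = integral {0..1} (\<lambda>t. of_real t ^ N * v (hd ss) (tl ss) (t *\<^sub>R x))" for ss x
  have "u x = (\<Sum>ss | length ss = Suc N. (\<Prod>s\<leftarrow>ss. x $ s) * w ss x)" if x: "x \<in> polydisc r" for x
  proof -
    have int: "integral {0..1} (\<lambda>t. partial_deriv s u (t *\<^sub>R x)) =
        (\<Sum>ss | length ss = N. (\<Prod>s\<leftarrow>ss. x $ s) * w (s # ss) x)" for s
    proof -
      have "integral {0..1} (\<lambda>t. partial_deriv s u (t *\<^sub>R x)) =
          integral {0..1} (\<lambda>t. \<Sum>ss | length ss = N. (\<Prod>s\<leftarrow>ss. x $ s) * (of_real t ^ N * v s ss (t *\<^sub>R x)))"
      proof (rule integral_cong)
        fix t :: real assume t: "t \<in> {0..1}"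
        show "partial_deriv s u (t *\<^sub>R x) =
            (\<Sum>ss | length ss = N. (\<Prod>s\<leftarrow>ss. x $ s) * (of_real t ^ N * v s ss (t *\<^sub>R x)))"
          using t scaleR_in_polydisc[OF x, of t]
          by (subst pd) (auto simp: prod_list_scaleR_nth mult_ac intro!: sum.cong)
      qed
      also have "\<dots> = (\<Sum>ss | length ss = N. integral {0..1} (\<lambda>t. (\<Prod>s\<leftarrow>ss. x $ s) * (of_real t ^ N * v s ss (t *\<^sub>R x))))"
        by (rule integral_sum[OF finite_lists_length])
           (auto intro!: integrable_continuous_interval continuous_intros continuous_on_hol_on_scaleR[OF v x])
      finally show ?thesis by (simp add: w_def)
    qed
    have "u 0 = 0" using Suc.prems(3)[of "[]"] by (simp add: iterated_partial_deriv_def)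
    then show ?thesis
      by (subst hol_on_Hadamard[OF Suc.prems(1) x])
         (auto simp: int sum_lists_length_Suc sum_distrib_left mult_ac)
  qed
  moreover have "hol_on (w ss) (polydisc r)" if "length ss = Suc N" for ss
    unfolding w_def using that by (intro hol_on_integral_scaleR v) auto
  ultimately show ?case by blast
qed

section \<open>Jets of differences\<close>

lemma partial_deriv_cong:
  assumes "x \<in> polydisc r" "\<And>y. y \<in> polydisc r \<Longrightarrow> u y = v y"
  shows "partial_deriv s u x = partial_deriv s (v :: complex^'n::finite \<Rightarrow> complex) x"
proof -
  have axis0: "axis s (0 :: complex) = (0 :: complex^'n)"
    by (simp add: vec_eq_iff axis_def)
  have "open (axis s -` ((\<lambda>y. x + y) -` polydisc r) :: complex set)"
  proof -
    have "continuous_on UNIV (\<lambda>t. x + axis s (t::complex))"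
      unfolding axis_def
    proof (intro continuous_intros continuous_on_vec_lambda)
      show "continuous_on UNIV (\<lambda>t. if i = s then t else (0 :: complex))" for i
        by (cases "i = s") (auto intro!: continuous_intros)
    qed
    then show ?thesis
      using open_vimage[OF open_polydisc] by (simp add: vimage_def)
  qed
  then have "\<forall>\<^sub>F t in nhds 0. x + axis s t \<in> polydisc r"
    using assms(1) eventually_nhds_in_open[of "axis s -` ((\<lambda>y. x + y) -` polydisc r)" 0]
    by (simp add: axis0)
  then show ?thesis
    unfolding partial_deriv_def by (intro deriv_cong_ev refl) (auto elim!: eventually_mono simp: assms(2))
qed

lemma iterated_partial_deriv_diff:
  fixes u v :: "complex^'n::finite \<Rightarrow> complex"
  assumes "hol_on u (polydisc r)" "hol_on v (polydisc r)"
    and "x \<in> polydisc r"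
  shows "iterated_partial_deriv ss (\<lambda>x. u x - v x) x =
      iterated_partial_deriv ss u x - iterated_partial_deriv ss v x"
proof -
  have hol: "hol_on (iterated_partial_deriv ss u) (polydisc r)" if "hol_on u (polydisc r)"
    for ss and u :: "complex^'n \<Rightarrow> complex"
    using that by (induction ss) (auto simp: iterated_partial_deriv_def intro: hol_on_partial_deriv)
  \<comment> \<open>The point \<open>x\<close> must vary in the induction, since the next derivative
    uses the identity in a whole neighbourhood.\<close>
  show ?thesis
    using assms(3)
  proof (induction ss arbitrary: x)
    case Nil
    then show ?case by (simp add: iterated_partial_deriv_def)
  next
    case (Cons s ss)
    let ?u = "iterated_partial_deriv ss u" and ?v = "iterated_partial_deriv ss v"
    have "iterated_partial_deriv (s # ss) (\<lambda>x. u x - v x) x =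
        partial_deriv s (iterated_partial_deriv ss (\<lambda>x. u x - v x)) x"
      by (simp add: iterated_partial_deriv_def)
    also have "\<dots> = partial_deriv s (\<lambda>x. ?u x - ?v x) x"
      by (rule partial_deriv_cong[OF Cons.prems Cons.IH])
    also have "\<dots> = partial_deriv s ?u x - partial_deriv s ?v x"
      using DERIV_unique[OF hol_on_has_partial_deriv(2)[OF hol_on_diff[OF hol[OF assms(1)] hol[OF assms(2)]] Cons.prems]
        DERIV_diff[OF hol_on_has_partial_deriv(2)[OF hol[OF assms(1)] Cons.prems]
          hol_on_has_partial_deriv(2)[OF hol[OF assms(2)] Cons.prems]]] .
    finally show ?case by (simp add: iterated_partial_deriv_def)
  qed
qed

section \<open>The ring of pullbacks along a germ\<close>

text \<open>
  \<open>pullback F\<close> is membership in the ring \<open>F\<^sup>* O\<close>, and \<open>pullback2 F\<close> is membership in \<open>F\<^sup>* \<mm>\<^sup>2\<close> for the maximal ideal \<open>\<mm>\<close> of the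
  local ring \<open>O\<close> of germs at \<open>0\<close> in the target.
\<close>

definition pullback :: "(complex^'n::finite \<Rightarrow> complex^'p::finite) \<Rightarrow> (complex^'n \<Rightarrow> complex) \<Rightarrow> bool" where
  "pullback F u \<longleftrightarrow>
     (\<exists>h r. 0 < r \<and> hol_on h (polydisc r) \<and> (\<forall>\<^sub>F x in nhds 0. u x = h (F x)))"

definition pullback2 :: "(complex^'n::finite \<Rightarrow> complex^'p::finite) \<Rightarrow> (complex^'n \<Rightarrow> complex) \<Rightarrow> bool" where
  "pullback2 F u \<longleftrightarrow>
     (\<exists>h r. 0 < r \<and> hol_on h (polydisc r) \<and> h 0 = 0 \<and> (h has_derivative (\<lambda>_. 0)) (at 0) \<and>
        (\<forall>\<^sub>F x in nhds 0. u x = h (F x)))"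

lemma pullbackI:
  "0 < r \<Longrightarrow> hol_on h (polydisc r) \<Longrightarrow> \<forall>\<^sub>F x in nhds 0. u x = h (F x) \<Longrightarrow> pullback F u"
  unfolding pullback_def by blast

lemma pullback_cong:
  assumes "\<forall>\<^sub>F x in nhds 0. u x = v x" "pullback F v"
  shows "pullback F u"
proof -
  obtain h r where "0 < r" "hol_on h (polydisc r)" "\<forall>\<^sub>F x in nhds 0. v x = h (F x)"
    using assms(2) by (auto simp: pullback_def)
  moreover have "\<forall>\<^sub>F x in nhds 0. u x = h (F x)"
    using assms(1) \<open>\<forall>\<^sub>F x in nhds 0. v x = h (F x)\<close> by eventually_elim simp
  ultimately show ?thesis by (intro pullbackI)
qed

lemma pullback_nth: "pullback F (\<lambda>x. F x $ q)"
  by (rule pullbackI[of 1 "\<lambda>y. y $ q"]) auto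

lemma pullback_const: "pullback F (\<lambda>x. c)"
  by (rule pullbackI[of 1 "\<lambda>y. c"]) auto

lemma pullback_binop:
  fixes F :: "complex^'n::finite \<Rightarrow> complex^'p::finite"
  assumes "pullback F u" "pullback F v"
    and op: "\<And>g h and U :: (complex^'p) set. hol_on g U \<Longrightarrow> hol_on h U \<Longrightarrow> hol_on (\<lambda>x. f (g x) (h x)) U"
  shows "pullback F (\<lambda>x. f (u x) (v x))"
proof -
  obtain h r where h: "0 < r" "hol_on h (polydisc r)" "\<forall>\<^sub>F x in nhds 0. u x = h (F x)"
    using assms(1) by (auto simp: pullback_def)
  obtain g r' where g: "0 < r'" "hol_on g (polydisc r')" "\<forall>\<^sub>F x in nhds 0. v x = g (F x)"
    using assms(2) by (auto simp: pullback_def)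
  show ?thesis
  proof (rule pullbackI)
    show "hol_on (\<lambda>x. f (h x) (g x)) (polydisc (min r r'))"
      by (rule op; rule hol_on_subset[OF h(2)] hol_on_subset[OF g(2)]; rule polydisc_mono) auto
    show "\<forall>\<^sub>F x in nhds 0. f (u x) (v x) = f (h (F x)) (g (F x))"
      using h(3) g(3) by eventually_elim simp
  qed (use h g in auto)
qed

lemma pullback_add: "pullback F u \<Longrightarrow> pullback F v \<Longrightarrow> pullback F (\<lambda>x. u x + v x)"
  by (rule pullback_binop) auto

lemma pullback_diff: "pullback F u \<Longrightarrow> pullback F v \<Longrightarrow> pullback F (\<lambda>x. u x - v x)"
  by (rule pullback_binop) auto

lemma pullback_mult: "pullback F u \<Longrightarrow> pullback F v \<Longrightarrow> pullback F (\<lambda>x. u x * v x)"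
  by (rule pullback_binop) auto

lemma pullback_power: "pullback F u \<Longrightarrow> pullback F (\<lambda>x. u x ^ n)"
  by (induction n) (auto intro: pullback_mult pullback_const)

lemma pullback_sum: "(\<And>i. i \<in> I \<Longrightarrow> pullback F (u i)) \<Longrightarrow> pullback F (\<lambda>x. \<Sum>i\<in>I. u i x)"
  by (induction I rule: infinite_finite_induct) (auto intro: pullback_add pullback_const)

lemma pullback2_cong:
  assumes "\<forall>\<^sub>F x in nhds 0. u x = v x" "pullback2 F v"
  shows "pullback2 F u"
proof -
  obtain h r where h: "0 < r" "hol_on h (polydisc r)" "h 0 = 0" "(h has_derivative (\<lambda>_. 0)) (at 0)"
    "\<forall>\<^sub>F x in nhds 0. v x = h (F x)"
    using assms(2) by (auto simp: pullback2_def)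
  moreover have "\<forall>\<^sub>F x in nhds 0. u x = h (F x)"
    using assms(1) h(5) by eventually_elim simp
  ultimately show ?thesis unfolding pullback2_def by blast
qed

lemma pullback2_add:
  assumes "pullback2 F u" "pullback2 F v"
  shows "pullback2 F (\<lambda>x. u x + v x)"
proof -
  obtain h r where h: "0 < r" "hol_on h (polydisc r)" "h 0 = 0" "(h has_derivative (\<lambda>_. 0)) (at 0)"
    "\<forall>\<^sub>F x in nhds 0. u x = h (F x)"
    using assms(1) by (auto simp: pullback2_def)
  obtain g r' where g: "0 < r'" "hol_on g (polydisc r')" "g 0 = 0" "(g has_derivative (\<lambda>_. 0)) (at 0)"
    "\<forall>\<^sub>F x in nhds 0. v x = g (F x)"
    using assms(2) by (auto simp: pullback2_def)
  have "hol_on (\<lambda>x. h x + g x) (polydisc (min r r'))"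
    by (intro hol_on_add hol_on_subset[OF h(2)] hol_on_subset[OF g(2)] polydisc_mono) auto
  moreover have "((\<lambda>x. h x + g x) has_derivative (\<lambda>_. 0)) (at 0)"
    using has_derivative_add[OF h(4) g(4)] by simp
  moreover have "\<forall>\<^sub>F x in nhds 0. u x + v x = h (F x) + g (F x)"
    using h(5) g(5) by eventually_elim simp
  ultimately show ?thesis
    unfolding pullback2_def using h(1,3) g(1,3)
    by (intro exI[of _ "\<lambda>x. h x + g x"] exI[of _ "min r r'"]) auto
qed

lemma pullback2_sum: "(\<And>i. i \<in> I \<Longrightarrow> pullback2 F (u i)) \<Longrightarrow> pullback2 F (\<lambda>x. \<Sum>i\<in>I. u i x)"
proof (induction I rule: infinite_finite_induct)
  case (insert i I)
  then show ?case by (auto intro: pullback2_add)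
qed (auto simp: pullback2_def intro!: exI[of _ "\<lambda>_. 0"] exI[of _ "1::real"])

text \<open>The square of a target coordinate lies in the square of the maximal ideal, and multiples
  of it stay there.\<close>

lemma pullback2_mult_nth:
  assumes "pullback F u"
  shows "pullback2 F (\<lambda>x. (F x $ q)\<^sup>2 * u x)"
proof -
  obtain h r where h: "0 < r" "hol_on h (polydisc r)" "\<forall>\<^sub>F x in nhds 0. u x = h (F x)"
    using assms by (auto simp: pullback_def)
  then obtain D where D: "(h has_derivative D) (at 0)" by (force simp: hol_on_def)
  have nth: "((\<lambda>y. y $ q) has_derivative (\<lambda>y. y $ q)) (at 0)"
    by (rule bounded_linear.has_derivative[OF bounded_linear_vec_nth]) simp
  have "((\<lambda>y. (y $ q * y $ q) * h y) has_derivative (\<lambda>_. 0)) (at 0)"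
    using has_derivative_mult[OF has_derivative_mult[OF nth nth] D] by simp
  moreover have "hol_on (\<lambda>y. (y $ q * y $ q) * h y) (polydisc r)"
    by (intro hol_on_mult hol_on_nth h)
  moreover have "\<forall>\<^sub>F x in nhds 0. (F x $ q)\<^sup>2 * u x = (F x $ q * F x $ q) * h (F x)"
    using h(3) by eventually_elim (simp add: power2_eq_square)
  ultimately show ?thesis
    unfolding pullback2_def using h(1)
    by (intro exI[of _ "\<lambda>y. (y $ q * y $ q) * h y"] exI[of _ r]) auto
qed

section \<open>Roots of unity and traces\<close>

lemma primitive_root_exists:
  assumes "0 < m"
  obtains \<zeta> :: complex where "norm \<zeta> = 1" "\<And>i. \<zeta> ^ i = 1 \<longleftrightarrow> m dvd i"
proof
  let ?z = "exp (2 * of_real pi * \<i> / of_nat m)"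
  have "?z ^ i = exp (2 * of_real pi * \<i> * of_nat i / of_nat m)" for i
    by (simp add: mult_ac flip: exp_of_nat_mult)
  then show "?z ^ i = 1 \<longleftrightarrow> m dvd i" for i
    using complex_root_unity_eq_1[of m i] assms by simp
  show "norm ?z = 1" by (simp add: norm_exp_eq_Re)
qed

lemma sum_powers_primitive_root:
  fixes \<zeta> :: complex
  assumes \<zeta>: "\<And>i. \<zeta> ^ i = 1 \<longleftrightarrow> m dvd i" and "b < m"
  shows "(\<Sum>t<m. (\<zeta> ^ t) ^ b) = (if b = 0 then of_nat m else 0)"
proof (cases "b = 0")
  case False
  then have "\<zeta> ^ b \<noteq> 1" using \<zeta> \<open>b < m\<close> by (auto dest: dvd_imp_le)
  moreover have "(\<zeta> ^ b) ^ m = 1" using \<zeta>[of "b * m"] by (simp add: power_mult)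
  ultimately have "(\<Sum>t<m. (\<zeta> ^ b) ^ t) = 0" by (simp add: geometric_sum)
  then show ?thesis using False by (simp add: mult.commute flip: power_mult)
qed simp

text \<open>Summing over the rotations by the powers of \<zeta> annihilates every residue class of
  exponents modulo \<open>m\<close> except the class of \<open>0\<close>, which is multiplied by
  \<open>m\<close> and is a function of \<open>z^m\<close>.\<close>

lemma trace_descends:
  fixes w :: "complex \<Rightarrow> complex"
  assumes w: "w holomorphic_on ball 0 r" "0 < r" and m: "0 < m"
    and \<zeta>: "norm \<zeta> = 1" "\<And>i. \<zeta> ^ i = 1 \<longleftrightarrow> m dvd i"
  shows "\<exists>C r'. 0 < r' \<and> C holomorphic_on ball 0 r' \<and>
    (\<forall>z. norm z < r' \<longrightarrow> (\<Sum>t<m. w (\<zeta> ^ t * z)) = C (z ^ m))"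
proof -
  \<comment> \<open>The function of one variable is viewed on \<open>complex^1\<close> so that
    Weierstrass division applies.\<close>
  have w1: "hol_on (\<lambda>x :: complex^1. w (x $ 1)) (polydisc r)"
    by (rule holomorphic_hol_on_compose[OF w(1)]) (auto simp: polydisc_def)
  obtain r' V where r': "0 < r'" "r' \<le> 1" and V: "\<And>b. hol_on (V b) (polydisc r')"
    and eq: "\<And>x :: complex^1. x \<in> polydisc r' \<Longrightarrow> w (x $ 1) = (\<Sum>b<m. x $ 1 ^ b * V b (vupd x 1 (x $ 1 ^ m)))"
    using hol_on_residue_classes[OF w1 w(2) m, where s = 1] by blast
  define C where "C z = of_nat m * V 0 (\<chi> i. z)" for z
  have wz: "w z = (\<Sum>b<m. z ^ b * V b (\<chi> i. z ^ m))" if "norm z < r'" for z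
  proof -
    have "vupd (\<chi> i. z) 1 (z ^ m) = ((\<chi> i. z ^ m) :: complex^1)"
      by (simp add: vec_eq_iff)
    then show ?thesis using eq[of "\<chi> i. z"] that by (simp add: polydisc_def)
  qed
  have "(\<Sum>t<m. w (\<zeta> ^ t * z)) = C (z ^ m)" if z: "norm z < r'" for z
  proof -
    have "\<zeta> ^ m = 1" using \<zeta>(2)[of m] by simp
    then have pow: "(\<zeta> ^ t * z) ^ m = z ^ m" for t
      by (simp add: power_mult_distrib mult.commute[of t] power_mult flip: power_mult)
         (simp add: power_mult)
    have wt: "w (\<zeta> ^ t * z) = (\<Sum>b<m. (\<zeta> ^ t) ^ b * (z ^ b * V b (\<chi> i. z ^ m)))" for t
    proof -
      have "norm (\<zeta> ^ t * z) < r'" using z \<zeta>(1) by (simp add: norm_mult norm_power)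
      from wz[OF this] show ?thesis
        unfolding pow by (simp add: power_mult_distrib mult_ac)
    qed
    have "(\<Sum>t<m. w (\<zeta> ^ t * z)) = (\<Sum>t<m. \<Sum>b<m. (\<zeta> ^ t) ^ b * (z ^ b * V b (\<chi> i. z ^ m)))"
      by (simp only: wt)
    also have "\<dots> = (\<Sum>b<m. (\<Sum>t<m. (\<zeta> ^ t) ^ b) * (z ^ b * V b (\<chi> i. z ^ m)))"
      by (subst sum.swap) (simp add: sum_distrib_right)
    also have "\<dots> = (\<Sum>b<m. if b = 0 then of_nat m * V 0 (\<chi> i. z ^ m) else 0)"
      by (rule sum.cong) (auto simp: sum_powers_primitive_root[OF \<zeta>(2)])
    also have "\<dots> = C (z ^ m)" using m by (simp add: C_def)
    finally show ?thesis .
  qed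
  moreover have "C holomorphic_on ball 0 r'"
    unfolding C_def by (intro holomorphic_on_mult holomorphic_on_const hol_on_compose_complex[OF V])
      (auto simp: polydisc_def intro: holomorphic_intros)
  ultimately show ?thesis using r' by blast
qed

lemma eventually_nth_norm_less:
  "0 < r \<Longrightarrow> \<forall>\<^sub>F x in nhds 0. norm ((x :: complex^'n::finite) $ j) < r"
  using eventually_polydisc by (rule eventually_mono) (auto simp: polydisc_def)

lemma pullback_compose_holomorphic_nth:
  assumes "C holomorphic_on ball 0 r" "0 < r"
    and "\<forall>\<^sub>F x in nhds 0. (F :: complex^'n::finite \<Rightarrow> complex^'p::finite) x $ q = u x"
  shows "pullback F (\<lambda>x. C (u x))"
proof (rule pullbackI[OF assms(2)])
  show "hol_on (\<lambda>y. C (y $ q)) (polydisc r)"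
    by (rule holomorphic_hol_on_compose[OF assms(1)]) (auto simp: polydisc_def)
  show "\<forall>\<^sub>F x in nhds 0. C (u x) = C (F x $ q)"
    using assms(3) by eventually_elim simp
qed

lemma holomorphic_on_rotate:
  fixes f :: "complex \<Rightarrow> complex"
  assumes "f holomorphic_on ball 0 r" "norm c = 1"
  shows "(\<lambda>z. f (c * z)) holomorphic_on ball 0 r"
proof -
  have "(f \<circ> (\<lambda>z. c * z)) holomorphic_on ball 0 r"
    by (rule holomorphic_on_compose_gen[OF _ assms(1)])
       (use assms(2) in \<open>auto simp: norm_mult intro!: holomorphic_intros\<close>)
  then show ?thesis by (simp add: o_def)
qed

text \<open>
  Induction on \<open>S\<close>: the factor for \<open>s\<close> splits the trace into \<open>\<phi>\<^sub>s(x\<^sub>j)\<close> times the trace of \<open>w\<close>, minus the trace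
  of \<open>z \<mapsto> w(z) \<phi>\<^sub>s(\<zeta>\<^sup>s z)\<close>. For \<open>S = {1..<m}\<close> all summands except the one for \<open>t = 0\<close> vanish.
\<close>

lemma pullback_twisted_trace:
  fixes F :: "complex^'n::finite \<Rightarrow> complex^'p::finite"
  assumes m: "0 < m" and r: "0 < r"
    and \<zeta>: "norm \<zeta> = 1" "\<And>i. \<zeta> ^ i = 1 \<longleftrightarrow> m dvd i"
    and q: "\<forall>\<^sub>F x in nhds 0. F x $ q = x $ j ^ m"
    and \<phi>: "\<And>s. s \<in> S \<Longrightarrow> \<phi> s holomorphic_on ball 0 r" "\<And>s. s \<in> S \<Longrightarrow> pullback F (\<lambda>x. \<phi> s (x $ j))"
    and "finite S" and w: "w holomorphic_on ball 0 r"
  shows "pullback F (\<lambda>x. \<Sum>t<m. w (\<zeta> ^ t * x $ j) *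
           (\<Prod>s\<in>S. \<phi> s (x $ j) - \<phi> s (\<zeta> ^ (s + t) * x $ j)))"
  using \<open>finite S\<close> \<phi> w
proof (induction S arbitrary: w)
  case empty
  obtain C r' where C: "0 < r'" "C holomorphic_on ball 0 r'"
    "\<forall>z. norm z < r' \<longrightarrow> (\<Sum>t<m. w (\<zeta> ^ t * z)) = C (z ^ m)"
    using trace_descends[OF empty(3) r m \<zeta>] by blast
  have "\<forall>\<^sub>F x in nhds 0. (\<Sum>t<m. w (\<zeta> ^ t * x $ j)) = C (x $ j ^ m)"
    using eventually_nth_norm_less[OF C(1), of j] by eventually_elim (simp add: C)
  then have "pullback F (\<lambda>x. \<Sum>t<m. w (\<zeta> ^ t * x $ j))"
    by (rule pullback_cong) (rule pullback_compose_holomorphic_nth[OF C(2,1) q])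
  then show ?case by simp
next
  case (insert a S)
  let ?P = "\<lambda>t x. \<Prod>s\<in>S. \<phi> s (x $ j) - \<phi> s (\<zeta> ^ (s + t) * x $ j)"
  let ?w = "\<lambda>z. w z * \<phi> a (\<zeta> ^ a * z)"
  have S: "\<And>s. s \<in> S \<Longrightarrow> \<phi> s holomorphic_on ball 0 r"
    "\<And>s. s \<in> S \<Longrightarrow> pullback F (\<lambda>x. \<phi> s (x $ j))"
    using insert.prems(1,2) by blast+
  have rot: "(\<lambda>z. \<phi> a (\<zeta> ^ a * z)) holomorphic_on ball 0 r"
    using insert.prems(1) \<zeta>(1) by (intro holomorphic_on_rotate) (auto simp: norm_power)
  have "?w holomorphic_on ball 0 r"
    by (intro holomorphic_on_mult rot insert.prems)
  from insert.IH[OF S this]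
  have "pullback F (\<lambda>x. \<Sum>t<m. ?w (\<zeta> ^ t * x $ j) * ?P t x)" .
  moreover have "pullback F (\<lambda>x. \<phi> a (x $ j) * (\<Sum>t<m. w (\<zeta> ^ t * x $ j) * ?P t x))"
    by (rule pullback_mult[OF insert.prems(2)[OF insertI1] insert.IH[OF S insert.prems(3)]])
  ultimately have diff: "pullback F (\<lambda>x. \<phi> a (x $ j) * (\<Sum>t<m. w (\<zeta> ^ t * x $ j) * ?P t x) - (\<Sum>t<m. ?w (\<zeta> ^ t * x $ j) * ?P t x))"
    by (rule pullback_diff[rotated])
  have "\<phi> a (x $ j) * (\<Sum>t<m. w (\<zeta> ^ t * x $ j) * ?P t x) - (\<Sum>t<m. ?w (\<zeta> ^ t * x $ j) * ?P t x) =
      (\<Sum>t<m. w (\<zeta> ^ t * x $ j) * (\<Prod>s\<in>insert a S. \<phi> s (x $ j) - \<phi> s (\<zeta> ^ (s + t) * x $ j)))" for x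
  proof -
    have alg: "c * (u * p) - u * b * p = u * ((c - b) * p)" for u b c p :: complex
      by (simp add: algebra_simps)
    have rot: "\<zeta> ^ a * (\<zeta> ^ t * x $ j) = \<zeta> ^ (a + t) * x $ j" for t
      by (simp add: power_add)
    show ?thesis
      unfolding sum_distrib_left sum_subtractf [symmetric] prod.insert[OF insert.hyps] alg rot ..
  qed
  then show ?case using diff by (simp only:)
qed

text \<open>The twisted trace collapses to its summand for \<open>t = 0\<close>. If all
  \<open>\<phi> s\<close> coincide, the product is the derivative of the characteristic polynomial
  of that function over the functions of \<open>z^m\<close>, evaluated at the function itself, as
  for the different of a field extension. Letting \<open>\<phi> s\<close> depend on \<open>s\<close>
  covers curves none of whose components alone separates all conjugates.\<close>

lemma pullback_mult_different:
  fixes F :: "complex^'n::finite \<Rightarrow> complex^'p::finite"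
  assumes m: "0 < m" and r: "0 < r"
    and \<zeta>: "norm \<zeta> = 1" "\<And>i. \<zeta> ^ i = 1 \<longleftrightarrow> m dvd i"
    and q: "\<forall>\<^sub>F x in nhds 0. F x $ q = x $ j ^ m"
    and \<phi>: "\<And>s. s \<in> {1..<m} \<Longrightarrow> \<phi> s holomorphic_on ball 0 r"
      "\<And>s. s \<in> {1..<m} \<Longrightarrow> pullback F (\<lambda>x. \<phi> s (x $ j))"
    and w: "w holomorphic_on ball 0 r"
  shows "pullback F (\<lambda>x. w (x $ j) * (\<Prod>s=1..<m. \<phi> s (x $ j) - \<phi> s (\<zeta> ^ s * x $ j)))"
proof -
  have "(\<Sum>t<m. w (\<zeta> ^ t * z) * (\<Prod>s=1..<m. \<phi> s z - \<phi> s (\<zeta> ^ (s + t) * z))) =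
      w z * (\<Prod>s=1..<m. \<phi> s z - \<phi> s (\<zeta> ^ s * z))" for z
  proof -
    \<comment> \<open>The factor for \<open>s = m - t\<close> vanishes, because \<zeta> to the power
      \<open>m\<close> is \<open>1\<close>.\<close>
    have "(\<Prod>s=1..<m. \<phi> s z - \<phi> s (\<zeta> ^ (s + t) * z)) = 0" if "t < m" "t \<noteq> 0" for t
    proof (rule prod_zero)
      have "\<zeta> ^ (m - t + t) = 1" using that \<zeta>(2)[of m] by simp
      then show "\<exists>s\<in>{1..<m}. \<phi> s z - \<phi> s (\<zeta> ^ (s + t) * z) = 0"
        using that by (intro bexI[of _ "m - t"]) auto
    qed simp
    then have "(\<Sum>t<m. w (\<zeta> ^ t * z) * (\<Prod>s=1..<m. \<phi> s z - \<phi> s (\<zeta> ^ (s + t) * z))) =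
        (\<Sum>t<m. if t = 0 then w z * (\<Prod>s=1..<m. \<phi> s z - \<phi> s (\<zeta> ^ s * z)) else 0)"
      by (intro sum.cong) auto
    then show ?thesis using m by simp
  qed
  moreover have "pullback F (\<lambda>x. \<Sum>t<m. w (\<zeta> ^ t * x $ j) * (\<Prod>s=1..<m. \<phi> s (x $ j) - \<phi> s (\<zeta> ^ (s + t) * x $ j)))"
    by (rule pullback_twisted_trace[OF m r \<zeta> q \<phi> _ w]) auto
  ultimately show ?thesis by simp
qed

section \<open>High powers of a single coordinate\<close>

lemma holomorphic_factor_power:
  fixes f :: "complex \<Rightarrow> complex"
  assumes "f holomorphic_on ball 0 r" "0 < r" "\<exists>z\<in>ball 0 r. f z \<noteq> 0"
  shows "\<exists>e d g. 0 < e \<and> e \<le> r \<and> g holomorphic_on ball 0 e \<and>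
    (\<forall>z\<in>ball 0 e. f z = g z * z ^ d \<and> g z \<noteq> 0)"
proof -
  obtain e where e: "e > 0" "zor_poly f 0 holomorphic_on cball 0 e"
    "\<forall>w\<in>cball 0 e. f w = zor_poly f 0 w * (w - 0) ^ nat (zorder f 0) \<and> zor_poly f 0 w \<noteq> 0"
    using zorder_exist_zero[OF assms(1) open_ball _ _ assms(3), of 0] assms(2) by auto
  have "zor_poly f 0 holomorphic_on ball 0 (min e r)"
    by (rule holomorphic_on_subset[OF e(2)]) auto
  with e(1,3) assms(2) show ?thesis
    by (intro exI[of _ "min e r"] exI[of _ "nat (zorder f 0)"] exI[of _ "zor_poly f 0"]) auto
qed

lemma eventually_nonzero_at_0:
  fixes f :: "complex \<Rightarrow> complex"
  assumes "f holomorphic_on ball 0 r" "0 < r" "\<exists>z\<in>ball 0 r. f z \<noteq> 0"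
  shows "\<forall>\<^sub>F z in at 0. f z \<noteq> 0"
proof -
  obtain e d g where e: "0 < e" "\<forall>z\<in>ball 0 e. f z = g z * z ^ d \<and> g z \<noteq> 0"
    using holomorphic_factor_power[OF assms] by blast
  have "\<forall>\<^sub>F z in at 0. z \<in> ball 0 e - {0 :: complex}"
    using e(1) by (intro eventually_at_in_open) auto
  then show ?thesis by eventually_elim (use e(2) in auto)
qed

text \<open>The different \<open>D\<close> is not identically zero, hence of the form
  \<open>g(z) z^d\<close> with a unit \<open>g\<close>. Since every holomorphic multiple of
  \<open>D\<close> is a pullback, so is every power from \<open>d\<close> on.\<close>

lemma pullback_large_powers:
  fixes F :: "complex^'n::finite \<Rightarrow> complex^'p::finite"
  assumes m: "0 < m" and r: "0 < r"
    and \<zeta>: "norm \<zeta> = 1" "\<And>i. \<zeta> ^ i = 1 \<longleftrightarrow> m dvd i"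
    and q: "\<forall>\<^sub>F x in nhds 0. F x $ q = x $ j ^ m"
    and \<phi>: "\<And>s. s \<in> {1..<m} \<Longrightarrow> \<phi> s holomorphic_on ball 0 r"
      "\<And>s. s \<in> {1..<m} \<Longrightarrow> pullback F (\<lambda>x. \<phi> s (x $ j))"
    and neq: "\<And>s. s \<in> {1..<m} \<Longrightarrow> \<exists>z\<in>ball 0 r. \<phi> s z \<noteq> \<phi> s (\<zeta> ^ s * z)"
  shows "\<exists>d. \<forall>M\<ge>d. pullback F (\<lambda>x. x $ j ^ M)"
proof -
  define D where "D z = (\<Prod>s=1..<m. \<phi> s z - \<phi> s (\<zeta> ^ s * z))" for z
  have hol: "(\<lambda>z. \<phi> s z - \<phi> s (\<zeta> ^ s * z)) holomorphic_on ball 0 r" if "s \<in> {1..<m}" for s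
    using \<phi>(1)[OF that] \<zeta>(1) by (intro holomorphic_on_diff holomorphic_on_rotate) (auto simp: norm_power)
  \<comment> \<open>Each of the finitely many factors is nonzero on a punctured neighbourhood of
    \<open>0\<close>, so some point avoids the zeros of all of them.\<close>
  have "\<forall>\<^sub>F z in at 0. \<forall>s\<in>{1..<m}. \<phi> s z - \<phi> s (\<zeta> ^ s * z) \<noteq> 0"
  proof (rule eventually_ball_finite)
    show "\<forall>s\<in>{1..<m}. \<forall>\<^sub>F z in at 0. \<phi> s z - \<phi> s (\<zeta> ^ s * z) \<noteq> 0"
      using neq by (intro ballI eventually_nonzero_at_0[OF hol r]) auto
  qed simp
  moreover have "\<forall>\<^sub>F z in at 0. z \<in> ball 0 r - {0 :: complex}"
    using r by (intro eventually_at_in_open) auto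
  ultimately have "\<forall>\<^sub>F z in at 0. z \<in> ball 0 r \<and> D z \<noteq> 0"
    by eventually_elim (auto simp: D_def)
  then have "\<exists>z\<in>ball 0 r. D z \<noteq> 0"
    using eventually_happens [of _ "at (0::complex)"] by force
  moreover have holD: "D holomorphic_on ball 0 r"
    unfolding D_def by (intro holomorphic_on_prod hol)
  ultimately obtain e d g where e: "0 < e" "e \<le> r" "g holomorphic_on ball 0 e"
    "\<And>z. z \<in> ball 0 e \<Longrightarrow> D z = g z * z ^ d \<and> g z \<noteq> 0"
    using holomorphic_factor_power[OF holD r] by blast
  have "pullback F (\<lambda>x. x $ j ^ M)" if "M \<ge> d" for M
  proof -
    \<comment> \<open>Multiplied by \<open>D = g(z) z^d\<close>, this gives exactly
      \<open>z^M\<close>.\<close>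
    let ?w = "\<lambda>z. z ^ (M - d) / g z"
    have sub: "ball 0 e \<subseteq> ball (0::complex) r" using e(2) by auto
    have "?w holomorphic_on ball 0 e"
      using e(4) by (intro holomorphic_intros e(3)) auto
    then have "pullback F (\<lambda>x. ?w (x $ j) * D (x $ j))"
      unfolding D_def using \<phi>(1)
      by (intro pullback_mult_different[OF m e(1) \<zeta> q _ \<phi>(2)]) (auto intro: holomorphic_on_subset[OF _ sub])
    moreover have "\<forall>\<^sub>F x in nhds 0. x $ j ^ M = ?w (x $ j) * D (x $ j)"
      using eventually_nth_norm_less[OF e(1), of j]
    proof eventually_elim
      case (elim x)
      then show ?case using e(4)[of "x $ j"] that by (simp flip: power_add)
    qed
    ultimately show ?thesis by (rule pullback_cong[rotated])
  qed
  then show ?thesis by blast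
qed

text \<open>Rotating the argument by \<zeta> multiplies the Taylor coefficient of index
  \<open>i\<close> by the power of \<zeta> with exponent \<open>i\<close>, so invariance forces that
  power to be \<open>1\<close> where the coefficient is nonzero.\<close>

lemma eval_fps_root_of_unity:
  fixes f :: "complex fps"
  assumes f: "0 < r" "ereal r \<le> fps_conv_radius f" and "norm \<zeta> = 1"
    and eq: "\<And>z. z \<in> ball 0 r \<Longrightarrow> eval_fps f (\<zeta> * z) = eval_fps f z"
    and "fps_nth f i \<noteq> 0"
  shows "\<zeta> ^ i = 1"
proof -
  have hol: "eval_fps f holomorphic_on ball 0 r"
  proof (intro holomorphic_on_eval_fps subsetI)
    fix z :: complex assume "z \<in> ball 0 r"
    then have "ereal (norm z) < ereal r" by simp
    also note f(2)
    finally show "z \<in> eball 0 (fps_conv_radius f)" by simp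
  qed
  have "(deriv ^^ i) (eval_fps f) 0 = (deriv ^^ i) (\<lambda>z. eval_fps f (\<zeta> * z)) 0"
  proof (rule higher_deriv_cong_ev)
    have "\<forall>\<^sub>F z in nhds 0. z \<in> ball (0::complex) r"
      using f(1) by (intro eventually_nhds_in_open) auto
    then show "\<forall>\<^sub>F z in nhds 0. eval_fps f z = eval_fps f (\<zeta> * z)"
      by eventually_elim (simp add: eq)
  qed simp
  also have "\<dots> = \<zeta> ^ i * (deriv ^^ i) (eval_fps f) (\<zeta> * 0)"
    using f(1) \<open>norm \<zeta> = 1\<close>
    by (intro higher_deriv_compose_linear[OF hol open_ball[of 0 r] open_ball]) (auto simp: norm_mult)
  finally have "fact i * fps_nth f i = \<zeta> ^ i * (fact i * fps_nth f i)"
    using f by (simp add: fps_nth_conv_deriv less_le_trans[of 0 "ereal r"])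
  then show ?thesis using \<open>fps_nth f i \<noteq> 0\<close> by simp
qed

section \<open>Finite determinacy by left equivalence\<close>

text \<open>
  The coordinates outside \<open>S\<close> enter \<open>v\<close> only through their \<open>m s\<close>-th powers. Freeing one more coordinate \<open>x\<^sub>a\<close>
  produces the factors \<open>x\<^sub>a\<^sup>b\<close> with \<open>b < m a\<close>, which cost \<open>\<mu> a * b\<close> powers of \<open>x\<^sub>j\<close>.
\<close>

lemma pullback_absorb:
  fixes F :: "complex^'n::finite \<Rightarrow> complex^'p::finite"
  assumes m: "\<And>s. 0 < m s"
    and q: "\<And>s. \<forall>\<^sub>F x in nhds 0. F x $ q s = x $ s ^ m s"
    and mix: "\<And>s. s \<noteq> j \<Longrightarrow> pullback F (\<lambda>x. x $ j ^ \<mu> s * x $ s)"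
    and pow: "\<And>M. d \<le> M \<Longrightarrow> pullback F (\<lambda>x. x $ j ^ M)"
  shows "\<exists>L. \<forall>M\<ge>L. \<forall>r>0. \<forall>v. hol_on v (polydisc r) \<longrightarrow>
    pullback F (\<lambda>x. x $ j ^ M * v (\<chi> s. if s \<in> S then x $ s else x $ s ^ m s))"
  using finite[of S]
proof (induction S rule: finite_induct)
  case empty
  \<comment> \<open>For empty \<open>S\<close> all arguments of \<open>v\<close> are pure powers,
    which are target coordinates. Hence \<open>v\<close> itself contributes a pullback and
    \<open>L = d\<close> works.\<close>
  have "pullback F (\<lambda>x. v (\<chi> s. x $ s ^ m s))" if v: "hol_on v (polydisc r)" "0 < r" for v r
  proof (rule pullbackI[OF v(2)])
    show "hol_on (\<lambda>y. v (\<chi> s. y $ q s)) (polydisc r)"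
      by (rule hol_on_compose[OF v(1)]) (auto simp: polydisc_def)
    have "\<forall>\<^sub>F x in nhds 0. \<forall>s. F x $ q s = x $ s ^ m s"
      by (rule eventually_all_finite[OF q])
    then show "\<forall>\<^sub>F x in nhds 0. v (\<chi> s. x $ s ^ m s) = v (\<chi> s. F x $ q s)"
      by eventually_elim simp
  qed
  then show ?case using pow by (intro exI[of _ d]) (auto intro!: pullback_mult)
next
  case (insert a S)
  let ?\<pi> = "\<lambda>S x. \<chi> s. if s \<in> S then x $ s else x $ s ^ m s"
  obtain L where L: "\<And>M r v. L \<le> M \<Longrightarrow> 0 < r \<Longrightarrow> hol_on v (polydisc r) \<Longrightarrow> pullback F (\<lambda>x. x $ j ^ M * v (?\<pi> S x))"
    using insert.IH by blast
  have "pullback F (\<lambda>x. x $ j ^ M * v (?\<pi> (insert a S) x))"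
    \<comment> \<open>The surplus \<open>\<mu> a * m a\<close> pays for every \<open>b < m a\<close>
      at once.\<close>
    if M: "L + \<mu> a * m a \<le> M" and r: "0 < r" and v: "hol_on v (polydisc r)" for M r v
  proof -
    obtain r' V where r': "0 < r'" "r' \<le> 1" and V: "\<And>b. hol_on (V b) (polydisc r')"
      and eq: "\<And>x. x \<in> polydisc r' \<Longrightarrow> v x = (\<Sum>b<m a. x $ a ^ b * V b (vupd x a (x $ a ^ m a)))"
      using hol_on_residue_classes[OF v r m[of a], of a] by blast
    have "pullback F (\<lambda>x. x $ j ^ M * (x $ a ^ b * V b (?\<pi> S x)))" if b: "b < m a" for b
    proof (cases "a = j")
      \<comment> \<open>Here the new factor is itself a power of \<open>x $ j\<close> and only
        raises the exponent.\<close>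
      case True
      have "pullback F (\<lambda>x. x $ j ^ (M + b) * V b (?\<pi> S x))"
        using M by (intro L[OF _ r'(1) V]) auto
      then show ?thesis using True by (simp add: power_add mult_ac)
    next
      case False
      have "\<mu> a * b \<le> \<mu> a * m a" using b by simp
      then have le: "L \<le> M - \<mu> a * b" "\<mu> a * b \<le> M" using M by linarith+
      have "pullback F (\<lambda>x. (x $ j ^ \<mu> a * x $ a) ^ b * (x $ j ^ (M - \<mu> a * b) * V b (?\<pi> S x)))"
        by (rule pullback_mult[OF pullback_power[OF mix[OF False]] L[OF le(1) r'(1) V]])
      moreover have "(x $ j ^ \<mu> a * x $ a) ^ b * (x $ j ^ (M - \<mu> a * b) * V b (?\<pi> S x)) =
          x $ j ^ M * (x $ a ^ b * V b (?\<pi> S x))" for x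
      proof -
        have "x $ j ^ M = (x $ j ^ \<mu> a) ^ b * x $ j ^ (M - \<mu> a * b)"
          using le(2) by (simp flip: power_mult power_add)
        then show ?thesis by (simp add: power_mult_distrib mult_ac)
      qed
      ultimately show ?thesis by (simp only:)
    qed
    then have "pullback F (\<lambda>x. \<Sum>b<m a. x $ j ^ M * (x $ a ^ b * V b (?\<pi> S x)))"
      by (intro pullback_sum) auto
    moreover have "\<forall>\<^sub>F x in nhds 0. x $ j ^ M * v (?\<pi> (insert a S) x) =
        (\<Sum>b<m a. x $ j ^ M * (x $ a ^ b * V b (?\<pi> S x)))"
      using eventually_polydisc[OF r'(1)]
    proof eventually_elim
      case (elim x)
      have "norm (?\<pi> (insert a S) x $ s) < r'" for s
      proof -
        have xs: "norm (x $ s) < r'" using elim by (simp add: polydisc_def)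
        then have "norm (x $ s) ^ m s \<le> norm (x $ s) ^ 1"
          using r' m[of s] by (intro power_decreasing) auto
        with xs show ?thesis by (auto simp: norm_power)
      qed
      then have "?\<pi> (insert a S) x \<in> polydisc r'" by (simp add: polydisc_def)
      \<comment> \<open>Raising the freed coordinate to the power \<open>m a\<close> restores the
        argument belonging to \<open>S\<close>, where the induction hypothesis applies.\<close>
      moreover have "vupd (?\<pi> (insert a S) x) a (?\<pi> (insert a S) x $ a ^ m a) = ?\<pi> S x"
        using insert.hyps(2) by (auto simp: vec_eq_iff)
      ultimately show ?case by (subst eq) (auto simp: sum_distrib_left)
    qed
    ultimately show ?thesis by (rule pullback_cong[rotated])
  qed
  then show ?case by blast
qed

section \<open>Absorbing functions with zero jet\<close>

lemma prod_list_nth_split: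
  fixes x :: "complex^'n::finite"
  shows "(\<Prod>s\<leftarrow>ss. x $ s) = x $ j ^ count_list ss j * (\<Prod>s\<leftarrow>filter (\<lambda>s. s \<noteq> j) ss. x $ s)"
  by (induction ss) (auto simp: mult_ac)

lemma hol_on_prod_list_nth: "hol_on (\<lambda>x. \<Prod>s\<leftarrow>ss. x $ s) U"
  by (induction ss) auto

lemma count_list_pigeonhole:
  fixes ss :: "'n::finite list"
  assumes "CARD('n) * K < length ss"
  shows "\<exists>j. K < count_list ss j"
proof (rule ccontr)
  assume "\<not> (\<exists>j. K < count_list ss j)"
  then have "(\<Sum>j\<in>UNIV. count_list ss j) \<le> CARD('n) * K"
    using sum_bounded_above[of "UNIV :: 'n set" "count_list ss" K] by (simp add: not_less)
  moreover have "(\<Sum>j\<in>UNIV. count_list ss j) = length ss"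
    by (rule sum_count_set) auto
  ultimately show False using assms by simp
qed

text \<open>In a monomial of large degree some \<open>x $ j\<close> occurs to a power of at least
  \<open>L j + 2 * m j\<close>. The part with exponent \<open>2 * m j\<close> is the square of a
  target coordinate and supplies second order vanishing; the part with exponent \<open>L j\<close>
  turns the remaining holomorphic factor into a pullback.\<close>

lemma zero_jet_pullback2:
  fixes F :: "complex^'n::finite \<Rightarrow> complex^'p::finite"
  assumes m: "\<And>s. 0 < m s"
    and q: "\<And>s. \<forall>\<^sub>F x in nhds 0. F x $ q s = x $ s ^ m s"
    and mix: "\<And>j s. s \<noteq> j \<Longrightarrow> pullback F (\<lambda>x. x $ j ^ \<mu> j s * x $ s)"
    and pow: "\<And>j. \<exists>d. \<forall>M\<ge>d. pullback F (\<lambda>x. x $ j ^ M)"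
  shows "\<exists>N. \<forall>r>0. \<forall>u. hol_on u (polydisc r) \<and>
    (\<forall>ss. length ss < N \<longrightarrow> iterated_partial_deriv ss u 0 = 0) \<longrightarrow> pullback2 F u"
proof -
  have "\<exists>L. \<forall>M\<ge>L. \<forall>r>0. \<forall>v. hol_on v (polydisc r) \<longrightarrow> pullback F (\<lambda>x. x $ j ^ M * v x)" for j
  proof -
    obtain d where "\<And>M. d \<le> M \<Longrightarrow> pullback F (\<lambda>x. x $ j ^ M)" using pow[of j] by blast
    from pullback_absorb[OF m q mix this, where S = UNIV] show ?thesis by simp
  qed
  then obtain L where L: "\<And>j r v. 0 < r \<Longrightarrow> hol_on v (polydisc r) \<Longrightarrow> pullback F (\<lambda>x. x $ j ^ L j * v x)"
    by (metis order_refl)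
  \<comment> \<open>The sum dominates the threshold \<open>L j + 2 * m j\<close> of every
    \<open>j\<close>, and a word longer than \<open>CARD('n) * K\<close> contains some letter more
    than \<open>K\<close> times.\<close>
  define K where "K = (\<Sum>j\<in>UNIV. L j + 2 * m j)"
  define N where "N = Suc (CARD('n) * K)"
  have monomial: "pullback2 F (\<lambda>x. (\<Prod>s\<leftarrow>ss. x $ s) * v x)"
    if r: "0 < r" and v: "hol_on v (polydisc r)" and len: "length ss = N" for r v and ss :: "'n list"
  proof -
    obtain j where "K < count_list ss j"
      using count_list_pigeonhole[of K ss] len by (auto simp: N_def)
    moreover have "L j + 2 * m j \<le> K"
      unfolding K_def by (rule member_le_sum[of j UNIV "\<lambda>j. L j + 2 * m j"]) auto
    ultimately obtain c where c: "count_list ss j = L j + 2 * m j + c"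
      using le_iff_add[of "L j + 2 * m j" "count_list ss j"] by force
    define w where "w x = x $ j ^ c * (\<Prod>s\<leftarrow>filter (\<lambda>s. s \<noteq> j) ss. x $ s) * v x" for x
    have "hol_on w (polydisc r)"
      unfolding w_def by (intro hol_on_mult hol_on_power hol_on_nth hol_on_prod_list_nth v)
    then have p: "pullback2 F (\<lambda>x. (F x $ q j)\<^sup>2 * (x $ j ^ L j * w x))"
      by (intro pullback2_mult_nth L[OF r])
    have "\<forall>\<^sub>F x in nhds 0. (\<Prod>s\<leftarrow>ss. x $ s) * v x = (F x $ q j)\<^sup>2 * (x $ j ^ L j * w x)"
      using q[of j]
    proof eventually_elim
      case (elim x)
      have "x $ j ^ count_list ss j = (F x $ q j)\<^sup>2 * x $ j ^ L j * x $ j ^ c"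
        by (simp add: elim c ac_simps flip: power_mult power_add)
      then show ?case
        unfolding prod_list_nth_split[of x ss j] by (simp add: w_def mult_ac)
    qed
    then show ?thesis using p by (rule pullback2_cong)
  qed
  have "pullback2 F u" if r: "0 < r" and u: "hol_on u (polydisc r)"
    and jet: "\<And>ss. length ss < N \<Longrightarrow> iterated_partial_deriv ss u 0 = 0" for r u
  proof -
    have "\<exists>v. (\<forall>ss. length ss = N \<longrightarrow> hol_on (v ss) (polydisc r)) \<and>
        (\<forall>x\<in>polydisc r. u x = (\<Sum>ss | length ss = N. (\<Prod>s\<leftarrow>ss. x $ s) * v ss x))"
      by (rule hol_on_zero_jet_decomposition[OF u r]) (rule jet)
    then obtain v where v: "\<And>ss. length ss = N \<Longrightarrow> hol_on (v ss) (polydisc r)"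
      "\<And>x. x \<in> polydisc r \<Longrightarrow> u x = (\<Sum>ss | length ss = N. (\<Prod>s\<leftarrow>ss. x $ s) * v ss x)"
      by blast
    have "\<forall>\<^sub>F x in nhds 0. u x = (\<Sum>ss | length ss = N. (\<Prod>s\<leftarrow>ss. x $ s) * v ss x)"
      using eventually_polydisc[OF r] by eventually_elim (rule v(2))
    then show ?thesis
    proof (rule pullback2_cong)
      show "pullback2 F (\<lambda>x. \<Sum>ss | length ss = N. (\<Prod>s\<leftarrow>ss. x $ s) * v ss x)"
        by (rule pullback2_sum, rule monomial[OF r v(1)]) auto
    qed
  qed
  then show ?thesis by blast
qed

section \<open>Biholomorphic germs tangent to the identity\<close>

definition gradients_blinfun :: "('p \<Rightarrow> 'n \<Rightarrow> complex) \<Rightarrow> (complex^'n::finite) \<Rightarrow>\<^sub>L (complex^'p::finite)" where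
  "gradients_blinfun c = (\<Sum>q\<in>UNIV. Blinfun (axis q) o\<^sub>L gradient_blinfun (c q))"

lemma bounded_linear_axis: "bounded_linear (axis q :: complex \<Rightarrow> complex^'p::finite)"
  unfolding linear_conv_bounded_linear [symmetric]
  by (rule linearI) (auto simp: vec_eq_iff axis_def)

lemma gradients_blinfun_apply:
  "blinfun_apply (gradients_blinfun c) = (\<lambda>h. \<chi> q. \<Sum>s\<in>UNIV. c q s * h $ s)"
proof
  fix h
  show "blinfun_apply (gradients_blinfun c) h = (\<chi> q. \<Sum>s\<in>UNIV. c q s * h $ s)"
    by (auto simp: gradients_blinfun_def blinfun.sum_left bounded_linear_Blinfun_apply[OF bounded_linear_axis]
        gradient_blinfun_apply vec_eq_iff axis_def)
qed

lemma continuous_on_gradients_blinfun: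
  "(\<And>q s. continuous_on S (\<lambda>x. c x q s)) \<Longrightarrow> continuous_on S (\<lambda>x. gradients_blinfun (c x))"
  unfolding gradients_blinfun_def by (intro continuous_intros continuous_on_gradient_blinfun)

lemma hol_on_components_has_derivative:
  fixes f :: "complex^'n::finite \<Rightarrow> complex^'p::finite"
  assumes "\<And>q. hol_on (\<lambda>x. f x $ q) U" "x \<in> U"
  shows "(f has_derivative (\<lambda>h. \<chi> q. \<Sum>s\<in>UNIV. partial_deriv s (\<lambda>x. f x $ q) x * h $ s)) (at x)"
  by (rule has_derivative_vecI, unfold vec_lambda_beta, rule hol_on_has_partial_deriv(1)[OF assms])

text \<open>Translates the matrix form of holomorphy on some open set into holomorphy of the
  components on a polydisc, the form used by all arguments above.\<close>

lemma map_germ_iff_hol_on: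
  fixes f :: "complex^'n::finite \<Rightarrow> complex^'p::finite"
  shows "map_germ f \<longleftrightarrow> f 0 = 0 \<and> (\<exists>r>0. \<forall>q. hol_on (\<lambda>x. f x $ q) (polydisc r))"
proof
  assume "map_germ f"
  then obtain U where U: "f 0 = 0" "open U" "0 \<in> U" "holomorphic_map_on f U"
    by (auto simp: map_germ_def)
  obtain r where r: "0 < r" "polydisc r \<subseteq> U"
    using open_contains_polydisc[OF U(2,3)] by blast
  have "hol_on (\<lambda>x. f x $ q) (polydisc r)" for q
    unfolding hol_on_def
  proof
    fix x :: "complex^'n" assume x: "x \<in> polydisc r"
    then have xU: "x \<in> U" using r(2) by blast
    then obtain A :: "complex^'n^'p" where "(f has_derivative (\<lambda>h. A *v h)) (at x within U)"
      using U(4) unfolding holomorphic_map_on_def by blast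
    then have "(f has_derivative (\<lambda>h. A *v h)) (at x)"
      by (simp only: at_within_open[OF xU U(2)])
    then have "((\<lambda>x. f x $ q) has_derivative (\<lambda>h. (A *v h) $ q)) (at x)"
      by (rule bounded_linear.has_derivative[OF bounded_linear_vec_nth])
    then show "\<exists>D. ((\<lambda>x. f x $ q) has_derivative D) (at x) \<and> (\<forall>c h. D (c *s h) = c * D h)"
      by (intro exI[of _ "\<lambda>h. (A *v h) $ q"]) (auto simp: matrix_vector_mult_def sum_distrib_left mult_ac)
  qed
  with U(1) r(1) show "f 0 = 0 \<and> (\<exists>r>0. \<forall>q. hol_on (\<lambda>x. f x $ q) (polydisc r))" by blast
next
  assume "f 0 = 0 \<and> (\<exists>r>0. \<forall>q. hol_on (\<lambda>x. f x $ q) (polydisc r))"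
  then obtain r where r: "f 0 = 0" "0 < r" "\<And>q. hol_on (\<lambda>x. f x $ q) (polydisc r)" by blast
  have "holomorphic_map_on f (polydisc r)"
    unfolding holomorphic_map_on_def
  proof
    fix x :: "complex^'n" assume x: "x \<in> polydisc r"
    define A :: "complex^'n^'p" where "A = (\<chi> q s. partial_deriv s (\<lambda>x. f x $ q) x)"
    have "(\<lambda>h. A *v h) = (\<lambda>h. \<chi> q. \<Sum>s\<in>UNIV. partial_deriv s (\<lambda>x. f x $ q) x * h $ s)"
      by (simp add: A_def matrix_vector_mult_def)
    with hol_on_components_has_derivative[OF r(3) x]
    show "\<exists>A :: complex^'n^'p. (f has_derivative (\<lambda>h. A *v h)) (at x within polydisc r)"
      by (intro exI[of _ A]) (simp add: has_derivative_at_withinI)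
  qed
  with r(1,2) show "map_germ f" by (auto simp: map_germ_def)
qed

lemma inv_scale:
  fixes D :: "complex^'n::finite \<Rightarrow> complex^'n"
  assumes "bij D" "\<And>c h. D (c *s h) = c *s D h"
  shows "inv D (c *s h) = c *s inv D h"
  using assms by (metis bij_inv_eq_iff)

text \<open>Since every \<open>h q\<close> vanishes to second order, the map has the identity as its
  derivative at \<open>0\<close>. The real inverse function theorem yields a local inverse, which is
  then shown to be holomorphic.\<close>

lemma biholomorphic_germ_tangent_to_identity:
  fixes h :: "'p::finite \<Rightarrow> complex^'p \<Rightarrow> complex"
  assumes r: "0 < r" and h: "\<And>q. hol_on (h q) (polydisc r)" "\<And>q. h q 0 = 0"
    "\<And>q. (h q has_derivative (\<lambda>_. 0)) (at 0)"
  shows "biholomorphic_germ (\<lambda>y. \<chi> q. y $ q + h q y)"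
proof -
  define f where "f y = (\<chi> q. y $ q + h q y)" for y
  define f' where "f' y = gradients_blinfun (\<lambda>q s. partial_deriv s (\<lambda>y. f y $ q) y)" for y
  have hol: "hol_on (\<lambda>y. f y $ q) (polydisc r)" for q
    by (simp add: f_def hol_on_add h)
  have der: "(f has_derivative blinfun_apply (f' y)) (at y)" if "y \<in> polydisc r" for y
    unfolding f'_def gradients_blinfun_apply by (rule hol_on_components_has_derivative[OF hol that])
  have cont: "continuous_on (polydisc r) f'"
    unfolding f'_def
    by (rule continuous_on_gradients_blinfun) (rule continuous_on_partial_deriv[OF hol])
  have f0: "f 0 = 0" by (simp add: f_def h vec_eq_iff)
  have "(f has_derivative (\<lambda>y. y)) (at 0)"
  proof (rule has_derivative_vecI)
    fix q :: 'p
    have "((\<lambda>y. y $ q) has_derivative (\<lambda>y. y $ q)) (at 0)"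
      by (rule bounded_linear.has_derivative[OF bounded_linear_vec_nth]) simp
    from has_derivative_add[OF this h(3)[of q]]
    show "((\<lambda>y. f y $ q) has_derivative (\<lambda>y. y $ q)) (at 0)" by (simp add: f_def)
  qed
  from has_derivative_unique[OF this der] r have "blinfun_apply (f' 0) = (\<lambda>y. y)" by simp
  then have id: "f' 0 = id_blinfun" by (intro blinfun_eqI) simp
  have scale: "blinfun_apply (f' y) (c *s x) = c *s blinfun_apply (f' y) x" for y c x
    by (simp add: f'_def gradients_blinfun_apply vec_eq_iff sum_distrib_left mult_ac)
  obtain U' V g g' where g: "open U'" "U' \<subseteq> polydisc r" "0 \<in> U'" "open V" "0 \<in> V" "homeomorphism U' V f g"
    "\<And>y. y \<in> V \<Longrightarrow> (g has_derivative (g' y)) (at y)"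
    "\<And>y. y \<in> V \<Longrightarrow> g' y = inv (blinfun_apply (f' (g y)))"
    "\<And>y. y \<in> V \<Longrightarrow> bij (blinfun_apply (f' (g y)))"
    using inverse_function_theorem_scaled[of "polydisc r" f f', OF open_polydisc der cont _ f0 id] r
    unfolding zero_in_polydisc by blast
  obtain r' where r': "0 < r'" "polydisc r' \<subseteq> V"
    using open_contains_polydisc[OF g(4,5)] by blast
  \<comment> \<open>The inverse of a complex linear bijection is complex linear, so the real
    derivative of \<open>g\<close> is a complex one.\<close>
  have g'_scale: "g' y (c *s x) = c *s g' y x" if "y \<in> V" for y c x
    unfolding g(8)[OF that] by (rule inv_scale[OF g(9)[OF that] scale])
  have "hol_on (\<lambda>y. g y $ q) (polydisc r')" for q
    unfolding hol_on_def
  proof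
    fix y :: "complex^'p" assume "y \<in> polydisc r'"
    then have y: "y \<in> V" using r' by blast
    from bounded_linear.has_derivative[OF bounded_linear_vec_nth g(7)[OF y]]
    have "((\<lambda>y. g y $ q) has_derivative (\<lambda>h. g' y h $ q)) (at y)" .
    then show "\<exists>D. ((\<lambda>y. g y $ q) has_derivative D) (at y) \<and> (\<forall>c h. D (c *s h) = c * D h)"
      by (intro exI[of _ "\<lambda>h. g' y h $ q"]) (auto simp: g'_scale[OF y])
  qed
  moreover have "g 0 = 0"
    using g(3,6) f0 by (metis homeomorphism_apply1)
  ultimately have "map_germ g" using r'(1) by (auto simp: map_germ_iff_hol_on)
  moreover have "map_germ f" using r hol f0 by (auto simp: map_germ_iff_hol_on)
  moreover have "\<forall>\<^sub>F x in nhds 0. g (f x) = x"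
    using eventually_nhds_in_open[OF g(1,3)]
    by eventually_elim (rule homeomorphism_apply1[OF g(6)])
  moreover have "\<forall>\<^sub>F x in nhds 0. f (g x) = x"
    using eventually_nhds_in_open[OF g(4,5)]
    by eventually_elim (rule homeomorphism_apply2[OF g(6)])
  ultimately have "inverse_germs f g" by (simp add: inverse_germs_def)
  then show ?thesis unfolding biholomorphic_germ_def f_def by blast
qed

text \<open>Each component of \<open>g - F\<close> has a zero jet and is therefore
  \<open>h q\<close> composed with \<open>F\<close>, where \<open>h q\<close> vanishes to second
  order. Adding these to the identity of the target gives the coordinate change that carries
  \<open>F\<close> to \<open>g\<close>.\<close>

lemma A_finite_if_pullback2:
  fixes F :: "complex^'n::finite \<Rightarrow> complex^'p::finite"
  assumes F: "map_germ F"
    and absorb: "\<And>r u. 0 < r \<Longrightarrow> hol_on u (polydisc r) \<Longrightarrow>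
      (\<And>ss. length ss < N \<Longrightarrow> iterated_partial_deriv ss u 0 = 0) \<Longrightarrow> pullback2 F u"
  shows "A_finite F"
  unfolding A_finite_def
proof (intro conjI F exI[of _ N] allI impI)
  fix g assume "map_germ g \<and> same_jet N F g"
  then have g: "map_germ g" and jet: "same_jet N F g" by auto
  obtain r1 where r1: "0 < r1" "\<And>q. hol_on (\<lambda>x. F x $ q) (polydisc r1)"
    using F by (auto simp: map_germ_iff_hol_on)
  obtain r2 where r2: "0 < r2" "\<And>q. hol_on (\<lambda>x. g x $ q) (polydisc r2)"
    using g by (auto simp: map_germ_iff_hol_on)
  define r where "r = min r1 r2"
  have r: "0 < r" "\<And>q. hol_on (\<lambda>x. F x $ q) (polydisc r)" "\<And>q. hol_on (\<lambda>x. g x $ q) (polydisc r)"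
    using r1 r2 polydisc_mono[of r r1] polydisc_mono[of r r2] by (auto simp: r_def intro: hol_on_subset)
  have "pullback2 F (\<lambda>x. g x $ q - F x $ q)" for q
  proof (rule absorb[OF r(1) hol_on_diff[OF r(3,2)]])
    fix ss :: "'n list" assume "length ss < N"
    then show "iterated_partial_deriv ss (\<lambda>x. g x $ q - F x $ q) 0 = 0"
      using iterated_partial_deriv_diff[OF r(3)[of q] r(2)[of q], where x = 0 and ss = ss] jet r(1)
      by (simp add: same_jet_def)
  qed
  then have "\<forall>q. \<exists>h r. 0 < r \<and> hol_on h (polydisc r) \<and> h 0 = 0 \<and> (h has_derivative (\<lambda>_. 0)) (at 0) \<and>
      (\<forall>\<^sub>F x in nhds 0. g x $ q - F x $ q = h (F x))"
    by (simp add: pullback2_def)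
  from choice[OF this] obtain h where "\<forall>q. \<exists>r. 0 < r \<and> hol_on (h q) (polydisc r) \<and> h q 0 = 0 \<and>
      (h q has_derivative (\<lambda>_. 0)) (at 0) \<and> (\<forall>\<^sub>F x in nhds 0. g x $ q - F x $ q = h q (F x))" ..
  from choice[OF this] obtain \<rho> where "\<forall>q. 0 < \<rho> q \<and> hol_on (h q) (polydisc (\<rho> q)) \<and> h q 0 = 0 \<and>
      (h q has_derivative (\<lambda>_. 0)) (at 0) \<and> (\<forall>\<^sub>F x in nhds 0. g x $ q - F x $ q = h q (F x))" ..
  then have h: "\<And>q. 0 < \<rho> q" "\<And>q. hol_on (h q) (polydisc (\<rho> q))" "\<And>q. h q 0 = 0"
    "\<And>q. (h q has_derivative (\<lambda>_. 0)) (at 0)" "\<And>q. \<forall>\<^sub>F x in nhds 0. g x $ q - F x $ q = h q (F x)"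
    by simp_all
  define \<epsilon> where "\<epsilon> = Min (range \<rho>)"
  have \<epsilon>: "0 < \<epsilon>" "\<And>q. \<epsilon> \<le> \<rho> q" using h(1) by (auto simp: \<epsilon>_def)
  define \<psi> where "\<psi> y = (\<chi> q. y $ q + h q y)" for y
  have "biholomorphic_germ \<psi>"
    unfolding \<psi>_def
    by (rule biholomorphic_germ_tangent_to_identity[OF \<epsilon>(1) _ h(3,4)])
       (rule hol_on_subset[OF h(2) polydisc_mono[OF \<epsilon>(2)]])
  \<comment> \<open>The coordinate change in the source is the identity.\<close>
  moreover have "map_germ (\<lambda>x :: complex^'n. x)"
    by (auto simp: map_germ_iff_hol_on intro: exI[of _ "1::real"])
  then have "inverse_germs (\<lambda>x :: complex^'n. x) (\<lambda>x. x)"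
    by (simp add: inverse_germs_def)
  moreover have "\<forall>\<^sub>F x in nhds 0. \<forall>q. g x $ q - F x $ q = h q (F x)"
    by (rule eventually_all_finite[OF h(5)])
  then have "\<forall>\<^sub>F x in nhds 0. g x = \<psi> (F x)"
    by eventually_elim (auto simp: \<psi>_def vec_eq_iff algebra_simps)
  ultimately show "A_equivalent F g"
    unfolding A_equivalent_def by blast
qed

section \<open>Joins of primitive curves\<close>

text \<open>If every component were invariant under the rotation, \<open>m\<close> would divide
  \<open>s * i\<close> for all occurring exponents \<open>i\<close>, hence also \<open>s\<close>
  times their gcd. That product is \<open>s\<close> by primitivity, which contradicts
  \<open>0 < s < m\<close>.\<close>

lemma primitive_curve_separates:
  fixes \<phi> :: "nat \<Rightarrow> complex fps"
  assumes prim: "primitive_curve k \<phi>"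
    and r: "0 < r" "\<And>l. l \<in> {1..k} \<Longrightarrow> ereal r \<le> fps_conv_radius (\<phi> l)"
    and \<zeta>: "norm \<zeta> = 1" "\<And>i. \<zeta> ^ i = 1 \<longleftrightarrow> m dvd i" and s: "s \<in> {1..<m}"
  shows "\<exists>l\<in>{1..k}. \<exists>z\<in>ball 0 r. eval_fps (\<phi> l) z \<noteq> eval_fps (\<phi> l) (\<zeta> ^ s * z)"
proof (rule ccontr)
  assume eq: "\<not> ?thesis"
  let ?I = "{i. \<exists>l\<in>{1..k}. fps_nth (\<phi> l) i \<noteq> 0}"
  have "m dvd s * i" if i: "i \<in> ?I" for i
  proof -
    obtain l where l: "l \<in> {1..k}" "fps_nth (\<phi> l) i \<noteq> 0" using i by blast
    have "(\<zeta> ^ s) ^ i = 1"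
    proof (rule eval_fps_root_of_unity[OF r(1) r(2)[OF l(1)] _ _ l(2)])
      show "eval_fps (\<phi> l) (\<zeta> ^ s * z) = eval_fps (\<phi> l) z" if "z \<in> ball 0 r" for z
        using eq l(1) that by auto
    qed (simp add: norm_power \<zeta>)
    then show ?thesis using \<zeta>(2) by (simp flip: power_mult)
  qed
  then have "m dvd Gcd ((*) s ` ?I)" by (intro Gcd_greatest) auto
  moreover have "Gcd ?I = 1" using prim by (simp add: primitive_curve_def)
  then have "Gcd ((*) s ` ?I) = s" by (simp add: Gcd_mult)
  ultimately show False using s by (auto dest: dvd_imp_le)
qed

lemma curve_component_nth_less: "i < m l \<Longrightarrow> fps_nth (curve_component m a l) i = 0"
  by (simp add: curve_component_def)

section \<open>Vanishing of the differential at the origin, and the corank\<close>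

lemma has_derivative_zero_monomial:
  fixes j s :: "'n::finite"
  assumes "1 \<le> n"
  shows "((\<lambda>x :: complex^'n. x $ j ^ n * x $ s) has_derivative (\<lambda>_. 0)) (at 0)"
proof -
  have nth: "((\<lambda>x :: complex^'n. x $ i) has_derivative (\<lambda>x. x $ i)) (at 0)" for i
    by (rule bounded_linear.has_derivative[OF bounded_linear_vec_nth]) simp
  show ?thesis
    using has_derivative_mult[OF has_derivative_power[OF nth[of j], of n] nth[of s]] assms
    by (simp add: power_0_left)
qed

lemma has_derivative_zero_eval_fps_nth:
  assumes "fps_nth f 1 = 0" "0 < fps_conv_radius f"
  shows "((\<lambda>x :: complex^'n::finite. eval_fps f (x $ j)) has_derivative (\<lambda>_. 0)) (at 0)"
proof -
  have nth: "((\<lambda>x :: complex^'n. x $ j) has_derivative (\<lambda>x. x $ j)) (at 0)"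
    by (rule bounded_linear.has_derivative[OF bounded_linear_vec_nth]) simp
  have "(eval_fps f has_field_derivative 0) (at ((0 :: complex^'n) $ j))"
    using has_field_derivative_eval_fps[of 0 f UNIV] assms
    by (simp add: eval_fps_at_0 zero_ereal_def)
  then have "(eval_fps f has_derivative (\<lambda>_. 0)) (at ((0 :: complex^'n) $ j))"
    by (simp add: has_field_derivative_def mult_zero_left [abs_def])
  from has_derivative_compose[OF nth this] show ?thesis .
qed

lemma corank_eq_if_derivative_zero:
  fixes F :: "complex^'n::finite \<Rightarrow> complex^'p::finite"
  assumes "(F has_derivative (\<lambda>_. 0)) (at 0)"
  shows "corank F = CARD('n)"
proof -
  have "jacobian F (at 0) = 0"
    unfolding jacobian_def frechet_derivative_at[OF assms, symmetric]
    by (simp add: matrix_def vec_eq_iff)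
  moreover have "rank (0 :: complex^'n^'p) = 0"
  proof -
    have "rows (0 :: complex^'n^'p) \<subseteq> vec.span {}"
      by (auto simp: rows_def row_def vec_eq_iff)
    then have "vec.dim (rows (0 :: complex^'n^'p)) \<le> card ({} :: (complex^'n) set)"
      by (rule vec.dim_le_card) simp
    then show ?thesis by (simp add: row_rank_def_gen)
  qed
  ultimately show ?thesis by (simp add: corank_def)
qed

theorem proposition3p5:
  fixes k :: "'n::finite \<Rightarrow> nat"
    and m :: "'n \<Rightarrow> nat \<Rightarrow> nat"
    and a :: "'n \<Rightarrow> nat \<Rightarrow> nat \<Rightarrow> complex"
    and \<mu> :: "'n \<Rightarrow> 'n \<Rightarrow> nat"
    and e :: "'p::finite \<Rightarrow> ('n \<times> nat) + ('n \<times> 'n)"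
    and \<phi> :: "'n \<Rightarrow> nat \<Rightarrow> complex fps"
    and F :: "complex^'n \<Rightarrow> complex^'p"
  assumes n: "CARD('n) \<ge> 2"
    and k: "\<And>j. k j \<ge> 1"
    and m_first: "\<And>j. 1 < m j 1"
    and m_mono: "\<And>j l. 1 \<le> l \<Longrightarrow> l < k j \<Longrightarrow> m j l \<le> m j (Suc l)"
    and phi: "\<And>j. \<phi> j = curve_component (m j) (a j)"
    and convergent: "\<And>j l. 1 \<le> l \<Longrightarrow> l \<le> k j \<Longrightarrow> fps_conv_radius (\<phi> j l) > 0"
    and primitive: "\<And>j. primitive_curve (k j) (\<phi> j)"
    and mu: "\<And>j s. s \<noteq> j \<Longrightarrow> \<mu> j s \<ge> 1"
    and coords: "bij_betw e UNIV (join_index k)"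
    and F: "F = curve_join \<phi> \<mu> e"
  shows "A_finite F \<and> corank F = CARD('n)"
proof -
  have m_gt1: "1 < m j l" if "1 \<le> l" "l \<le> k j" for j l
    using that
  proof (induction l rule: dec_induct)
    case base
    show ?case by (rule m_first)
  next
    case (step l)
    then show ?case using m_mono[of l j] by simp
  qed
  have e_in: "e q \<in> join_index k" for q
    using coords by (auto simp: bij_betw_def)
  have e_Inl: "1 \<le> l \<and> l \<le> k j" if "e q = Inl (j, l)" for q j l
    using e_in[of q] that by (auto simp: join_index_def)
  have e_Inr: "s \<noteq> j" if "e q = Inr (j, s)" for q j s
    using e_in[of q] that by (auto simp: join_index_def)
  have F_Inl: "F x $ q = eval_fps (\<phi> j l) (x $ j)" if "e q = Inl (j, l)" for x q j l
    using that by (simp add: F curve_join_def)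
  have F_Inr: "F x $ q = x $ j ^ \<mu> j s * x $ s" if "e q = Inr (j, s)" for x q j s
    using that by (simp add: F curve_join_def)

  have ex_Inl: "\<exists>q. e q = Inl (j, l)" if "l \<in> {1..k j}" for j l
  proof -
    have "Inl (j, l) \<in> join_index k" using that by (auto simp: join_index_def)
    then show ?thesis using coords by (metis bij_betw_imp_surj_on imageE)
  qed
  have ex_Inr: "\<exists>q. e q = Inr (j, s)" if "s \<noteq> j" for j s
  proof -
    have "Inr (j, s) \<in> join_index k" using that by (auto simp: join_index_def)
    then show ?thesis using coords by (metis bij_betw_imp_surj_on imageE)
  qed

  \<comment> \<open>Radii are attached to the finitely many target coordinates so that a minimum
    exists. Coordinates coming from \<open>H\<close> impose no condition and receive the value
    \<open>1\<close>.\<close>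
  have "\<exists>r>0. \<forall>j l. e q = Inl (j, l) \<longrightarrow> ereal r \<le> fps_conv_radius (\<phi> j l)" for q
  proof (cases "e q")
    case (Inl p)
    obtain j l where p: "p = (j, l)" by (cases p)
    have "0 < fps_conv_radius (\<phi> j l)" using e_Inl[of q j l] convergent Inl p by simp
    then obtain r where "0 < ereal r" "ereal r < fps_conv_radius (\<phi> j l)"
      using ereal_dense2 by blast
    then show ?thesis using Inl p by (intro exI[of _ r]) auto
  qed (auto intro: exI[of _ "1::real"])
  then obtain \<rho> where \<rho>: "\<And>q. 0 < \<rho> q" "\<And>q j l. e q = Inl (j, l) \<Longrightarrow> ereal (\<rho> q) \<le> fps_conv_radius (\<phi> j l)"
    by metis
  define r where "r = Min (range \<rho>)"
  have r: "0 < r" using \<rho>(1) by (auto simp: r_def)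
  have r_le: "ereal r \<le> fps_conv_radius (\<phi> j l)" if l: "l \<in> {1..k j}" for j l
  proof -
    obtain q where q: "e q = Inl (j, l)" using ex_Inl[OF l] by blast
    have "r \<le> \<rho> q" by (simp add: r_def)
    then have "ereal r \<le> ereal (\<rho> q)" by simp
    also note \<rho>(2)[OF q]
    finally show ?thesis .
  qed
  have hol_phi: "eval_fps (\<phi> j l) holomorphic_on ball 0 r" if l: "l \<in> {1..k j}" for j l
  proof (intro holomorphic_on_eval_fps subsetI)
    fix z :: complex assume "z \<in> ball 0 r"
    then have "ereal (norm z) < ereal r" by simp
    also note r_le[OF l]
    finally show "z \<in> eball 0 (fps_conv_radius (\<phi> j l))" by simp
  qed
  have low: "fps_nth (\<phi> j l) i = 0" if "1 \<le> l" "l \<le> k j" "i \<le> 1" for j l i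
    unfolding phi using m_gt1[OF that(1,2)] that(3) by (intro curve_component_nth_less) simp

  \<comment> \<open>Every component has order at least two: the curve exponents exceed
    \<open>1\<close>, and the monomials of \<open>H\<close> have degree at least
    \<open>1 + 1\<close>. This gives both the germ property and rank zero at the origin.\<close>
  have comp: "hol_on (\<lambda>x. F x $ q) (polydisc r) \<and> F 0 $ q = 0 \<and>
      ((\<lambda>x. F x $ q) has_derivative (\<lambda>_. 0)) (at 0)" for q
  proof (cases "e q")
    case (Inl p)
    obtain j l where p: "p = (j, l)" by (cases p)
    have l: "1 \<le> l" "l \<le> k j" using e_Inl[of q j l] Inl p by auto
    have "hol_on (\<lambda>x. eval_fps (\<phi> j l) (x $ j)) (polydisc r)"
      using l by (intro holomorphic_hol_on_compose[OF hol_phi]) (auto simp: polydisc_def)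
    moreover have "eval_fps (\<phi> j l) 0 = 0" using low[OF l, of 0] by (simp add: eval_fps_at_0)
    ultimately show ?thesis
      using has_derivative_zero_eval_fps_nth[OF low[OF l, of 1] convergent[OF l]] Inl p
      by (simp add: F_Inl)
  next
    case (Inr p)
    obtain j s where p: "p = (j, s)" by (cases p)
    have "hol_on (\<lambda>x. x $ j ^ \<mu> j s * x $ s) (polydisc r)"
      by (intro hol_on_mult hol_on_power hol_on_nth)
    then show ?thesis
      using has_derivative_zero_monomial[OF mu[OF e_Inr[of q j s]], of j s] Inr p
      by (simp add: F_Inr)
  qed

  have germ: "map_germ F"
    using comp r by (auto simp: map_germ_iff_hol_on vec_eq_iff)
  have "corank F = CARD('n)"
    using comp by (intro corank_eq_if_derivative_zero has_derivative_vecI) simp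
  have phi_pullback: "pullback F (\<lambda>x. eval_fps (\<phi> j l) (x $ j))" if l: "l \<in> {1..k j}" for j l
  proof -
    obtain q where q: "e q = Inl (j, l)" using ex_Inl[OF l] by blast
    show ?thesis using pullback_nth[of F q] unfolding F_Inl[OF q] .
  qed
  have mix: "pullback F (\<lambda>x. x $ j ^ \<mu> j s * x $ s)" if s: "s \<noteq> j" for j s
  proof -
    obtain q where q: "e q = Inr (j, s)" using ex_Inr[OF s] by blast
    show ?thesis using pullback_nth[of F q] unfolding F_Inr[OF q] .
  qed
  have "\<exists>q. e q = Inl (j, 1)" for j
    using k[of j] by (intro ex_Inl) simp
  \<comment> \<open>The first component of each curve is the pure power, so \<open>q j\<close> is
    the target coordinate that carries it.\<close>
  then obtain q where q: "\<And>j. e (q j) = Inl (j, 1)" by metis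
  have F_q: "F x $ q j = x $ j ^ m j 1" for x j
    unfolding F_Inl[OF q] by (simp add: phi curve_component_def eval_fps_power)
  have pow: "\<exists>d. \<forall>M\<ge>d. pullback F (\<lambda>x. x $ j ^ M)" for j
  proof -
    have m0: "0 < m j 1" using m_first[of j] by simp
    obtain \<zeta> :: complex where \<zeta>: "norm \<zeta> = 1" "\<And>i. \<zeta> ^ i = 1 \<longleftrightarrow> m j 1 dvd i"
      using primitive_root_exists[OF m0] by blast
    \<comment> \<open>Primitivity provides, for each nontrivial rotation, a component that detects
      it; which component does so may depend on \<open>s\<close>.\<close>
    have "\<forall>s\<in>{1..<m j 1}. \<exists>l. l \<in> {1..k j} \<and>
        (\<exists>z\<in>ball 0 r. eval_fps (\<phi> j l) z \<noteq> eval_fps (\<phi> j l) (\<zeta> ^ s * z))"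
      using primitive_curve_separates[OF primitive r r_le \<zeta>] by blast
    from bchoice[OF this] obtain l where l: "\<And>s. s \<in> {1..<m j 1} \<Longrightarrow> l s \<in> {1..k j}"
      "\<And>s. s \<in> {1..<m j 1} \<Longrightarrow> \<exists>z\<in>ball 0 r. eval_fps (\<phi> j (l s)) z \<noteq> eval_fps (\<phi> j (l s)) (\<zeta> ^ s * z)"
      by blast
    show ?thesis
    proof (rule pullback_large_powers[OF m0 r \<zeta>, where \<phi> = "\<lambda>s. eval_fps (\<phi> j (l s))"])
      show "\<forall>\<^sub>F x in nhds 0. F x $ q j = x $ j ^ m j 1" by (simp add: F_q)
    qed (rule hol_phi[OF l(1)] phi_pullback[OF l(1)] l(2), assumption)+
  qed
  obtain N where N: "\<And>r u. 0 < r \<Longrightarrow> hol_on u (polydisc r) \<Longrightarrow>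
      (\<And>ss. length ss < N \<Longrightarrow> iterated_partial_deriv ss u 0 = 0) \<Longrightarrow> pullback2 F u"
  proof -
    have "0 < m s 1" for s using m_first[of s] by simp
    moreover have "\<forall>\<^sub>F x in nhds 0. F x $ q s = x $ s ^ m s 1" for s by (simp add: F_q)
    ultimately show ?thesis
      using zero_jet_pullback2[of "\<lambda>s. m s 1" F q \<mu>, OF _ _ mix pow] that by blast
  qed
  have "A_finite F"
    by (rule A_finite_if_pullback2[OF germ N])
  with \<open>corank F = CARD('n)\<close> show ?thesis by blast
qed

end
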